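(* A generic cone framework is minimally rigid if and only if the associated colored graph $(G,\boldsymbol\gamma)$ is cone-Laman.
   Context: Let $k\in\{2,3,4,6\}$ and let $R_k$ be the counterclockwise rotation about the origin of $\mathbb R^2$ by angle $2\pi/k$; $\mathbb Z/k\mathbb Z$ acts on $\mathbb R^2$ by letting the generator act as $R_k$, written $\gamma\cdot\mathbf p$. **Cone frameworks.** A cone framework $(\tilde G,\varphi,\tilde{\boldsymbol\ell})$ consists of a finite graph $\tilde G=(\tilde V,\tilde E)$, a free $\mathbb Z/k\mathbb Z$-action $\varphi$ on $\tilde G$, and positive lengths $\tilde\ell_{ij}$ on the edges. A realization is a point set $\mathbf p=(\mathbf p_i)_{i\in\tilde V}$ in $\mathbb R^2$ with $\|\mathbf p_j-\mathbf p_i\|=\tilde\ell_{ij}$ for all $ij\in\tilde E$ and $\gamma\cdot\mathbf p_i=\mathbf p_{\gamma(i)}$ for all $\gamma\in\mathbb Z/k\mathbb Z$, $i\in\tilde V$. The configuration space is the space of realizations modulo rotations about the origin. A realization is rigid if it is isolated in the configuration space, and minimally rigid if it is rigid but ceases to be so when any $\mathbb Z/k\mathbb Z$-orbit of edges is removed. **Colored graphs.** A $\mathbb Z/k\mathbb Z$-colored graph $(G,\boldsymbol\gamma)$ is a finite directed multigraph (loops allowed) with an element $\gamma_{ij}\in\mathbb Z/k\mathbb Z$ on each edge $ij$. The associated colored graph of $(\tilde G,\varphi)$ is $G=\tilde G/(\mathbb Z/k\mathbb Z)$ with arbitrary edge orientations; choosing a representative $\tilde i$ of each vertex orbit, the edge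 from $i$ to $j$ gets the color $\gamma_{ij}$ such that the edge in the corresponding orbit with tail $\tilde i$ has head $\gamma_{ij}(\tilde j)$. For a closed path $P$ crossing edges $e_1,\dots,e_t$, $\rho(P)=\gamma_{e_1}^{\epsilon_1}\cdots\gamma_{e_t}^{\epsilon_t}$ with $\epsilon_s=\pm1$ according to whether $e_s$ is crossed forwards or backwards. For a connected colored graph $G$, $T(G)=0$ if some closed path has non-trivial $\rho$-image, and $T(G)=2$ otherwise. $(G,\boldsymbol\gamma)$ with $n$ vertices and $m$ edges is cone-Laman if $m=2n-1$ and every subgraph with $m'\ge1$ edges, $n'$ vertices and connected components $G_1,\dots,G_c$ satisfies $m'\le 2n'-1-\sum_{i=1}^cT(G_i)$. **Genericity.** Realizations correspond to $\mathbf p=(\mathbf p_i)_{i\in V(G)}\in\mathbb R^{2n}$ with $\|\gamma_{ij}\cdot\mathbf p_j-\mathbf p_i\|^2=\ell_{ij}^2$ for the edges $ij$ of $G$. A realization is generic if the rank of the Jacobian of $\mathbf p\mapsto(\|\gamma_{ij}\cdot\mathbf p_j-\mathbf p_i\|^2)_{ij\in E(G)}$ at $\mathbf p$ is maximal over all realizations of all cone frameworks with the same colored graph; non-generic realizations form a proper algebraic subset. "A generic cone framework is minimally rigid" means that its generic realizations are. *)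

theory Defs
  imports
    "HOL-Analysis.Analysis"
    "Graph_Theory.Digraph_Component"
    "HOL-Algebra.Group_Action"
    "HOL-Algebra.Elementary_Groups"
begin

section \<open>Cone frameworks\<close>

text \<open>
  The plane is identified with the complex numbers, so that a rotation about the origin is
  multiplication by a number \<open>cis t\<close>.  The cyclic group of order \<open>k\<close> is
  \<open>integer_mod_group k\<close>, with carrier \<open>{0..<int k}\<close> for positive \<open>k\<close>; its generator \<open>1\<close> acts
  as the counterclockwise rotation by \<open>2 * pi / k\<close>.
\<close>

definition cone_rot :: "nat \<Rightarrow> int \<Rightarrow> complex \<Rightarrow> complex"
  where "cone_rot k g z = cis (2 * pi * of_int g / of_nat k) * z"

text \<open>
  The vertices of the symmetric graph are the elements of a finite type; since types are inhabited,
  the graph has at least one vertex.  An edge is a two-element set of vertices.  Freeness is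
  required on the vertices: for even \<open>k\<close> the element \<open>k div 2\<close> may interchange the two ends of an
  edge, and such an edge becomes a loop of color \<open>k div 2\<close> in the colored graph.
\<close>

definition free_symmetric_graph :: "nat \<Rightarrow> (int \<Rightarrow> 'v::finite \<Rightarrow> 'v) \<Rightarrow> 'v set set \<Rightarrow> bool"
  where "free_symmetric_graph k \<phi> E \<longleftrightarrow>
     (\<forall>e\<in>E. card e = 2) \<and>
     group_action (integer_mod_group k) (UNIV :: 'v set) \<phi> \<and>
     (\<forall>g\<in>carrier (integer_mod_group k). \<forall>e\<in>E. \<phi> g ` e \<in> E) \<and>
     (\<forall>g\<in>carrier (integer_mod_group k). g \<noteq> \<one>\<^bsub>integer_mod_group k\<^esub> \<longrightarrow> (\<forall>v. \<phi> g v \<noteq> v))"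

definition cone_framework ::
    "nat \<Rightarrow> (int \<Rightarrow> 'v::finite \<Rightarrow> 'v) \<Rightarrow> 'v set set \<Rightarrow> ('v set \<Rightarrow> real) \<Rightarrow> bool"
  where "cone_framework k \<phi> E l \<longleftrightarrow> free_symmetric_graph k \<phi> E \<and> (\<forall>e\<in>E. l e > 0)"

definition edge_orbit :: "nat \<Rightarrow> (int \<Rightarrow> 'v \<Rightarrow> 'v) \<Rightarrow> 'v set \<Rightarrow> 'v set set"
  where "edge_orbit k \<phi> e = Group_Action.orbit (integer_mod_group k) (\<lambda>g. image (\<phi> g)) e"

definition realizations ::
    "nat \<Rightarrow> (int \<Rightarrow> 'v::finite \<Rightarrow> 'v) \<Rightarrow> 'v set set \<Rightarrow> ('v set \<Rightarrow> real) \<Rightarrow> (complex ^ 'v) set"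
  where "realizations k \<phi> E l =
     {p. (\<forall>i j. {i, j} \<in> E \<longrightarrow> norm (p $ j - p $ i) = l {i, j}) \<and>
         (\<forall>g\<in>carrier (integer_mod_group k). \<forall>i. cone_rot k g (p $ i) = p $ \<phi> g i)}"

definition rotation_class :: "complex ^ 'v::finite \<Rightarrow> (complex ^ 'v) set"
  where "rotation_class p = {(\<chi> i. cis t * p $ i) | t. True}"

text \<open>
  The configuration space carries the quotient topology; see \<open>quotient_map_config_space\<close>.
\<close>

definition config_space ::
    "nat \<Rightarrow> (int \<Rightarrow> 'v::finite \<Rightarrow> 'v) \<Rightarrow> 'v set set \<Rightarrow> ('v set \<Rightarrow> real)
       \<Rightarrow> (complex ^ 'v) set topology"
  where "config_space k \<phi> E l = topology (\<lambda>U.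
     U \<subseteq> rotation_class ` realizations k \<phi> E l \<and>
     openin (top_of_set (realizations k \<phi> E l)) {p \<in> realizations k \<phi> E l. rotation_class p \<in> U})"

lemma openin_config_space:
  "openin (config_space k \<phi> E l) U \<longleftrightarrow>
     U \<subseteq> rotation_class ` realizations k \<phi> E l \<and>
     openin (top_of_set (realizations k \<phi> E l)) {p \<in> realizations k \<phi> E l. rotation_class p \<in> U}"
proof -
  let ?R = "realizations k \<phi> E l"
  have "istopology (\<lambda>U. U \<subseteq> rotation_class ` ?R \<and>
          openin (top_of_set ?R) {p \<in> ?R. rotation_class p \<in> U})"
    unfolding istopology_def
  proof (intro conjI allI impI)
    fix S T
    assume "S \<subseteq> rotation_class ` ?R \<and> openin (top_of_set ?R) {p \<in> ?R. rotation_class p \<in> S}"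
      and "T \<subseteq> rotation_class ` ?R \<and> openin (top_of_set ?R) {p \<in> ?R. rotation_class p \<in> T}"
    then show "S \<inter> T \<subseteq> rotation_class ` ?R"
      and "openin (top_of_set ?R) {p \<in> ?R. rotation_class p \<in> S \<inter> T}"
      using openin_Int[of "top_of_set ?R" "{p \<in> ?R. rotation_class p \<in> S}"
          "{p \<in> ?R. rotation_class p \<in> T}"]
      by (auto simp: Int_def conj_ac cong: conj_cong)
  next
    fix K
    assume K: "\<forall>U\<in>K. U \<subseteq> rotation_class ` ?R \<and>
                  openin (top_of_set ?R) {p \<in> ?R. rotation_class p \<in> U}"
    then show "\<Union>K \<subseteq> rotation_class ` ?R" by blast
    have "openin (top_of_set ?R) (\<Union>U\<in>K. {p \<in> ?R. rotation_class p \<in> U})"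
      using K by blast
    also have "(\<Union>U\<in>K. {p \<in> ?R. rotation_class p \<in> U}) = {p \<in> ?R. rotation_class p \<in> \<Union>K}"
      by blast
    finally show "openin (top_of_set ?R) {p \<in> ?R. rotation_class p \<in> \<Union>K}" .
  qed
  then show ?thesis
    by (simp add: config_space_def)
qed

lemma topspace_config_space:
  "topspace (config_space k \<phi> E l) = rotation_class ` realizations k \<phi> E l"
proof -
  have "{p \<in> realizations k \<phi> E l. rotation_class p \<in> rotation_class ` realizations k \<phi> E l}
          = realizations k \<phi> E l"
    by blast
  then have "openin (config_space k \<phi> E l) (rotation_class ` realizations k \<phi> E l)"
    by (simp add: openin_config_space)
  then show ?thesis
    by (auto simp: topspace_def openin_config_space)
qed

lemma quotient_map_config_space:
  "quotient_map (top_of_set (realizations k \<phi> E l)) (config_space k \<phi> E l) rotation_class"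
  by (simp add: quotient_map_def topspace_config_space openin_config_space)

definition rigid ::
    "nat \<Rightarrow> (int \<Rightarrow> 'v::finite \<Rightarrow> 'v) \<Rightarrow> 'v set set \<Rightarrow> ('v set \<Rightarrow> real) \<Rightarrow> complex ^ 'v \<Rightarrow> bool"
  where "rigid k \<phi> E l p \<longleftrightarrow>
     p \<in> realizations k \<phi> E l \<and> openin (config_space k \<phi> E l) {rotation_class p}"

definition minimally_rigid ::
    "nat \<Rightarrow> (int \<Rightarrow> 'v::finite \<Rightarrow> 'v) \<Rightarrow> 'v set set \<Rightarrow> ('v set \<Rightarrow> real) \<Rightarrow> complex ^ 'v \<Rightarrow> bool"
  where "minimally_rigid k \<phi> E l p \<longleftrightarrow>
     rigid k \<phi> E l p \<and> (\<forall>e\<in>E. \<not> rigid k \<phi> (E - edge_orbit k \<phi> e) l p)"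


section \<open>Colored graphs\<close>

text \<open>
  A colored graph is a finite directed multigraph \<open>G\<close>, loops allowed, with a color function
  \<open>\<gamma>\<close> on its arcs.  A path is a list of arcs, each marked with the direction in which it is
  crossed: \<open>True\<close> is forwards, \<open>False\<close> is backwards.
\<close>

definition colored_graph :: "nat \<Rightarrow> ('a, 'b) pre_digraph \<Rightarrow> ('b \<Rightarrow> int) \<Rightarrow> bool"
  where "colored_graph k G \<gamma> \<longleftrightarrow>
     fin_digraph G \<and> (\<forall>a\<in>arcs G. \<gamma> a \<in> carrier (integer_mod_group k))"

primrec colored_path :: "('a, 'b) pre_digraph \<Rightarrow> 'a \<Rightarrow> ('b \<times> bool) list \<Rightarrow> 'a \<Rightarrow> bool"
  where
    "colored_path G u [] v \<longleftrightarrow> u \<in> verts G \<and> u = v"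
  | "colored_path G u (s # P) v \<longleftrightarrow>
       fst s \<in> arcs G \<and> u = (if snd s then tail G (fst s) else head G (fst s)) \<and>
       colored_path G (if snd s then head G (fst s) else tail G (fst s)) P v"

primrec path_color :: "nat \<Rightarrow> ('b \<Rightarrow> int) \<Rightarrow> ('b \<times> bool) list \<Rightarrow> int"
  where
    "path_color k \<gamma> [] = \<one>\<^bsub>integer_mod_group k\<^esub>"
  | "path_color k \<gamma> (s # P) =
       (if snd s then \<gamma> (fst s) else inv\<^bsub>integer_mod_group k\<^esub> (\<gamma> (fst s)))
         \<otimes>\<^bsub>integer_mod_group k\<^esub> path_color k \<gamma> P"

definition T_number :: "nat \<Rightarrow> ('b \<Rightarrow> int) \<Rightarrow> ('a, 'b) pre_digraph \<Rightarrow> int"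
  where "T_number k \<gamma> G =
     (if \<exists>u P. colored_path G u P u \<and> path_color k \<gamma> P \<noteq> \<one>\<^bsub>integer_mod_group k\<^esub> then 0 else 2)"

text \<open>
  The constant \<open>Digraph_Component.connected\<close> ignores the orientation of the arcs.
\<close>

definition components :: "('a, 'b) pre_digraph \<Rightarrow> ('a, 'b) pre_digraph set"
  where "components G = {C. pre_digraph.max_subgraph G Digraph_Component.connected C}"

definition cone_laman :: "nat \<Rightarrow> ('a, 'b) pre_digraph \<Rightarrow> ('b \<Rightarrow> int) \<Rightarrow> bool"
  where "cone_laman k G \<gamma> \<longleftrightarrow>
     int (card (arcs G)) = 2 * int (card (verts G)) - 1 \<and>
     (\<forall>H. subgraph H G \<and> card (arcs H) \<ge> 1 \<longrightarrow>
        int (card (arcs H)) \<le>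
          2 * int (card (verts H)) - 1 - (\<Sum>C\<in>components H. T_number k \<gamma> C))"

text \<open>
  \<open>(G, \<gamma>)\<close> is a colored graph of the quotient of \<open>(UNIV, E)\<close>: \<open>rep i\<close> is the chosen
  representative of the vertex orbit labelled \<open>i\<close>, the arcs of \<open>G\<close> label the edge orbits, and the
  edge with tail \<open>rep i\<close> in the orbit labelled by an arc \<open>a\<close> from \<open>i\<close> to \<open>j\<close> has head
  \<open>\<phi> (\<gamma> a) (rep j)\<close>.  All choices of labels, representatives and orientations are allowed.
\<close>

definition associated_colored_graph ::
    "nat \<Rightarrow> (int \<Rightarrow> 'v::finite \<Rightarrow> 'v) \<Rightarrow> 'v set set \<Rightarrow> ('w::finite \<Rightarrow> 'v)
       \<Rightarrow> ('w, 'e) pre_digraph \<Rightarrow> ('e \<Rightarrow> int) \<Rightarrow> bool"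
  where "associated_colored_graph k \<phi> E rep G \<gamma> \<longleftrightarrow>
     colored_graph k G \<gamma> \<and> verts G = UNIV \<and>
     bij_betw (\<lambda>i. Group_Action.orbit (integer_mod_group k) \<phi> (rep i))
       UNIV (orbits (integer_mod_group k) UNIV \<phi>) \<and>
     bij_betw (\<lambda>a. edge_orbit k \<phi> {rep (tail G a), \<phi> (\<gamma> a) (rep (head G a))})
       (arcs G) (edge_orbit k \<phi> ` E)"


section \<open>Genericity\<close>

text \<open>
  The arcs of \<open>G\<close> need not exhaust the type \<open>'e\<close> (they may even be absent); the coordinates
  outside \<open>arcs G\<close> are constantly zero and do not contribute to the rank.
\<close>

definition squared_lengths ::
    "nat \<Rightarrow> ('w::finite, 'e::finite) pre_digraph \<Rightarrow> ('e \<Rightarrow> int) \<Rightarrow> complex ^ 'w \<Rightarrow> real ^ 'e"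
  where "squared_lengths k G \<gamma> p =
     (\<chi> a. if a \<in> arcs G then (norm (cone_rot k (\<gamma> a) (p $ head G a) - p $ tail G a))\<^sup>2 else 0)"

definition jacobian_rank ::
    "nat \<Rightarrow> ('w::finite, 'e::finite) pre_digraph \<Rightarrow> ('e \<Rightarrow> int) \<Rightarrow> complex ^ 'w \<Rightarrow> nat"
  where "jacobian_rank k G \<gamma> p =
     dim (range (frechet_derivative (squared_lengths k G \<gamma>) (at p)))"

definition restrict_to_reps :: "('w::finite \<Rightarrow> 'v::finite) \<Rightarrow> complex ^ 'v \<Rightarrow> complex ^ 'w"
  where "restrict_to_reps rep p = (\<chi> i. p $ rep i)"

text \<open>
  In the maximality condition the competing frameworks may be taken on the same vertex type,
  because the colored graph and \<open>k\<close> determine the number of vertices.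
\<close>

definition generic_realization ::
    "nat \<Rightarrow> (int \<Rightarrow> 'v::finite \<Rightarrow> 'v) \<Rightarrow> 'v set set \<Rightarrow> ('v set \<Rightarrow> real)
       \<Rightarrow> ('w::finite \<Rightarrow> 'v) \<Rightarrow> ('w, 'e::finite) pre_digraph \<Rightarrow> ('e \<Rightarrow> int) \<Rightarrow> complex ^ 'v \<Rightarrow> bool"
  where "generic_realization k \<phi> E l rep G \<gamma> p \<longleftrightarrow>
     p \<in> realizations k \<phi> E l \<and>
     (\<forall>(\<phi>' :: int \<Rightarrow> 'v \<Rightarrow> 'v) E' l' rep' q.
        cone_framework k \<phi>' E' l' \<and> associated_colored_graph k \<phi>' E' rep' G \<gamma> \<and>
        q \<in> realizations k \<phi>' E' l' \<longrightarrow>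
        jacobian_rank k G \<gamma> (restrict_to_reps rep' q) \<le> jacobian_rank k G \<gamma> (restrict_to_reps rep p))"


subsection \<open>Existence of generic realizations\<close>

text \<open>
  Every free symmetric graph has lengths that admit a generic realization, whatever the choices
  made for its colored graph; so statements about all generic realizations are never vacuous.
\<close>

lemma cone_rot_add:
  assumes "k > 0"
  shows "cone_rot k ((g + h) mod int k) z = cone_rot k g (cone_rot k h z)"
proof -
  define m where "m = (g + h) div int k"
  have "(g + h) mod int k = g + h - int k * m"
    by (simp add: m_def minus_mult_div_eq_mod)
  then have "real_of_int ((g + h) mod int k) = of_int g + of_int h - real k * of_int m"
    by (simp only: of_int_add of_int_diff of_int_mult of_int_of_nat_eq)
  then have "2 * pi * of_int ((g + h) mod int k) / real k
     = 2 * pi * of_int g / real k + 2 * pi * of_int h / real k + 2 * pi * of_int (- m)"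
    using assms by (simp only:) (simp add: field_simps)
  then have "cis (2 * pi * of_int ((g + h) mod int k) / real k)
     = cis (2 * pi * of_int g / real k) * cis (2 * pi * of_int h / real k) * cis (2 * pi * of_int (- m))"
    by (simp only: cis_mult)
  also have "cis (2 * pi * of_int (- m)) = 1"
    by (rule cis_multiple_2pi) simp
  finally show ?thesis by (simp add: cone_rot_def)
qed

lemma cis_cone_neq_1:
  assumes "0 < g" "g < int k"
  shows "cis (2 * pi * of_int g / real k) \<noteq> 1"
proof
  assume "cis (2 * pi * of_int g / real k) = 1"
  then have "cos (2 * pi * of_int g / real k) = 1"
    by (metis cis.simps(1) one_complex.simps(1))
  then obtain n :: int where "2 * pi * of_int g / real k = of_int n * (2 * pi)"
    using cos_one_2pi_int by (metis mult.commute mult.left_commute)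
  then have "real_of_int g = of_int n * real k"
    using assms by (simp add: field_simps)
  then have "g = n * int k"
    by (metis of_int_eq_iff of_int_mult of_int_of_nat_eq)
  then show False
    using assms by (metis dvd_triv_right zdvd_not_zless)
qed

lemma norm_cone_rot_diff: "norm (cone_rot k g z - cone_rot k g w) = norm (z - w)"
  by (simp add: cone_rot_def norm_mult flip: right_diff_distrib)

lemma ex_realization_over_reps:
  fixes \<phi> :: "int \<Rightarrow> 'v::finite \<Rightarrow> 'v" and r :: "complex ^ 'w::finite"
  assumes k: "k > 0"
    and graph: "free_symmetric_graph k \<phi> E"
    and assoc: "associated_colored_graph k \<phi> E rep G \<gamma>"
    and nz: "\<And>a. a \<in> arcs G \<Longrightarrow> cone_rot k (\<gamma> a) (r $ head G a) \<noteq> r $ tail G a"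
  shows "\<exists>l p. cone_framework k \<phi> E l \<and> p \<in> realizations k \<phi> E l \<and> restrict_to_reps rep p = r"
proof -
  let ?Z = "integer_mod_group k"
  have act: "group_action ?Z UNIV \<phi>"
    and card2: "\<And>e. e \<in> E \<Longrightarrow> card e = 2"
    and free: "\<And>g v. g \<in> carrier ?Z \<Longrightarrow> \<phi> g v = v \<Longrightarrow> g = 0"
    using graph by (auto simp: free_symmetric_graph_def)
  have car: "carrier ?Z = {0..<int k}"
    using k by (simp add: carrier_integer_mod_group)
  have comp: "\<phi> ((g + h) mod int k) v = \<phi> g (\<phi> h v)"
    if "g \<in> carrier ?Z" "h \<in> carrier ?Z" for g h v
    using group_action.composition_rule[OF act _ that, of v] by simp
  have zero: "\<phi> 0 v = v" for v
    using group_action.id_eq_one[OF act] by (simp add: fun_eq_iff)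
  have inv: "\<phi> ((- g) mod int k) (\<phi> g v) = v" if "g \<in> carrier ?Z" for g v
    using comp[of "(- g) mod int k" g v] that k by (simp add: car zero mod_simps)
  have inj: "i = j \<and> g = h"
    if "g \<in> carrier ?Z" "h \<in> carrier ?Z" and eq: "\<phi> g (rep i) = \<phi> h (rep j)" for g h i j
  proof -
    have "rep i = \<phi> ((- g) mod int k) (\<phi> h (rep j))"
      using inv that by metis
    also have "\<dots> = \<phi> (((- g) mod int k + h) mod int k) (rep j)"
      using that k by (intro comp[symmetric]) (auto simp: car)
    finally have ij: "rep i = \<phi> (((- g) mod int k + h) mod int k) (rep j)" .
    then have "rep i \<in> orbit ?Z \<phi> (rep j)"
      using k by (auto simp: Group_Action.orbit_def car)
    then have "orbit ?Z \<phi> (rep i) = orbit ?Z \<phi> (rep j)"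
      using group_action.orbit_trans[OF act] group_action.orbit_sym[OF act] by blast
    then have "i = j"
      using assoc by (auto simp: associated_colored_graph_def bij_betw_def inj_on_def)
    moreover have "((- g) mod int k + h) mod int k = 0"
      using ij \<open>i = j\<close> k by (intro free[of _ "rep j"]) (auto simp: car)
    then have "(h - g) mod int k = 0" by (simp add: mod_simps)
    then have "g = h"
      using that k unfolding car
      by (metis atLeastLessThan_iff mod_eq_0_iff_dvd mod_eq_dvd_iff mod_pos_pos_trivial)
    ultimately show ?thesis by simp
  qed
  have surj: "\<exists>i. \<exists>g\<in>carrier ?Z. v = \<phi> g (rep i)" for v
  proof -
    have "orbit ?Z \<phi> v \<in> range (\<lambda>i. orbit ?Z \<phi> (rep i))"
      using assoc by (auto simp: associated_colored_graph_def bij_betw_def orbits_def)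
    then obtain i where "orbit ?Z \<phi> v = orbit ?Z \<phi> (rep i)" by auto
    moreover have "v \<in> orbit ?Z \<phi> v"
      using group_action.orbit_refl[OF act] by simp
    ultimately show ?thesis by (auto simp: Group_Action.orbit_def)
  qed
  define p where
    "p = (\<chi> v. THE z. \<exists>i. \<exists>g\<in>carrier ?Z. v = \<phi> g (rep i) \<and> z = cone_rot k g (r $ i))"
  have p: "p $ \<phi> g (rep i) = cone_rot k g (r $ i)" if "g \<in> carrier ?Z" for g i
    unfolding p_def using that by (auto intro!: the_equality dest: inj)
  have equi: "cone_rot k g (p $ v) = p $ \<phi> g v" if g: "g \<in> carrier ?Z" for g v
  proof -
    obtain i h where v: "h \<in> carrier ?Z" "v = \<phi> h (rep i)" using surj by blast
    have "p $ \<phi> g v = p $ \<phi> ((g + h) mod int k) (rep i)"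
      using g v comp by simp
    also have "\<dots> = cone_rot k ((g + h) mod int k) (r $ i)"
      using k by (intro p) (auto simp: car)
    also have "\<dots> = cone_rot k g (p $ v)"
      using v p k by (simp add: cone_rot_add)
    finally show ?thesis by simp
  qed
  define l where "l e = Max ((\<lambda>(i, j). norm (p $ j - p $ i)) ` (e \<times> e))" for e
  have l: "l {i, j} = norm (p $ j - p $ i)" for i j
    unfolding l_def by (auto simp: norm_minus_commute insert_Times_insert)
  have pos: "l e > 0" if e: "e \<in> E" for e
  proof -
    have "edge_orbit k \<phi> e \<in> (\<lambda>a. edge_orbit k \<phi> {rep (tail G a), \<phi> (\<gamma> a) (rep (head G a))}) ` arcs G"
      using assoc e by (auto simp: associated_colored_graph_def bij_betw_def)
    then obtain a where a: "a \<in> arcs G"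
      and eo: "edge_orbit k \<phi> e = edge_orbit k \<phi> {rep (tail G a), \<phi> (\<gamma> a) (rep (head G a))}"
      by blast
    have "e = \<phi> 0 ` e" by (simp add: zero)
    then have "e \<in> edge_orbit k \<phi> e"
      unfolding edge_orbit_def Group_Action.orbit_def
      by (smt (verit) integer_mod_group_0 mem_Collect_eq)
    then obtain g where g: "g \<in> carrier ?Z"
      and "e = \<phi> g ` {rep (tail G a), \<phi> (\<gamma> a) (rep (head G a))}"
      unfolding eo by (auto simp: edge_orbit_def Group_Action.orbit_def)
    then have "e = {\<phi> g (rep (tail G a)), \<phi> g (\<phi> (\<gamma> a) (rep (head G a)))}" by simp
    then have "l e = norm (cone_rot k g (p $ \<phi> (\<gamma> a) (rep (head G a))) - cone_rot k g (r $ tail G a))"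
      using l p[OF g] equi[OF g] by simp
    also have "\<dots> = norm (cone_rot k (\<gamma> a) (r $ head G a) - r $ tail G a)"
      using assoc a by (simp add: norm_cone_rot_diff p associated_colored_graph_def colored_graph_def)
    also have "\<dots> > 0" using nz[OF a] by simp
    finally show ?thesis .
  qed
  have "restrict_to_reps rep p = r"
    using p[of 0] k by (simp add: restrict_to_reps_def vec_eq_iff car zero cone_rot_def)
  moreover have "p \<in> realizations k \<phi> E l"
    using equi l by (auto simp: realizations_def)
  ultimately show ?thesis
    using pos graph unfolding cone_framework_def by blast
qed

lemma realization_arc_nonzero:
  assumes k: "k > 0" and fw: "cone_framework k \<phi> E l"
    and assoc: "associated_colored_graph k \<phi> E rep G \<gamma>"
    and q: "q \<in> realizations k \<phi> E l" and a: "a \<in> arcs G"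
  shows "cone_rot k (\<gamma> a) (restrict_to_reps rep q $ head G a) \<noteq> restrict_to_reps rep q $ tail G a"
    and "{rep (tail G a), \<phi> (\<gamma> a) (rep (head G a))} \<in> E"
proof -
  let ?Z = "integer_mod_group k" and ?e = "{rep (tail G a), \<phi> (\<gamma> a) (rep (head G a))}"
  have act: "group_action ?Z UNIV \<phi>"
    and inv: "\<And>g e. g \<in> carrier ?Z \<Longrightarrow> e \<in> E \<Longrightarrow> \<phi> g ` e \<in> E"
    using fw by (auto simp: cone_framework_def free_symmetric_graph_def)
  have zero: "\<phi> 0 v = v" for v
    using group_action.id_eq_one[OF act] by (simp add: fun_eq_iff)
  have "edge_orbit k \<phi> ?e \<in> edge_orbit k \<phi> ` E"
    using assoc a unfolding associated_colored_graph_def bij_betw_def by blast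
  then obtain e where e: "e \<in> E" "edge_orbit k \<phi> ?e = edge_orbit k \<phi> e" by blast
  have "?e = \<phi> 0 ` ?e" by (simp add: zero)
  then have "?e \<in> edge_orbit k \<phi> ?e"
    unfolding edge_orbit_def Group_Action.orbit_def by (smt (verit) integer_mod_group_0 mem_Collect_eq)
  then show E: "?e \<in> E"
    unfolding e using e inv by (auto simp: edge_orbit_def Group_Action.orbit_def)
  have "\<gamma> a \<in> carrier ?Z"
    using assoc a by (auto simp: associated_colored_graph_def colored_graph_def)
  then have "norm (cone_rot k (\<gamma> a) (q $ rep (head G a)) - q $ rep (tail G a)) = l ?e"
    using q E by (auto simp: realizations_def)
  then show "cone_rot k (\<gamma> a) (restrict_to_reps rep q $ head G a) \<noteq> restrict_to_reps rep q $ tail G a"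
    using fw E by (auto simp: cone_framework_def restrict_to_reps_def)
qed

lemma ex_generic_realization:
  fixes \<phi> :: "int \<Rightarrow> 'v::finite \<Rightarrow> 'v" and rep :: "'w::finite \<Rightarrow> 'v"
    and G :: "('w, 'e::finite) pre_digraph"
  assumes k: "k > 0"
    and graph: "free_symmetric_graph k \<phi> E"
    and assoc: "associated_colored_graph k \<phi> E rep G \<gamma>"
  shows "\<exists>l p. cone_framework k \<phi> E l \<and> generic_realization k \<phi> E l rep G \<gamma> p"
proof -
  define N where "N = {r :: complex ^ 'w. \<forall>a\<in>arcs G. cone_rot k (\<gamma> a) (r $ head G a) \<noteq> r $ tail G a}"
  obtain f :: "'w \<Rightarrow> nat" where f: "inj f"
    using finite_imp_inj_to_nat_seg[of "UNIV :: 'w set"] by auto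
  have "(\<chi> i. of_nat (Suc (f i))) \<in> N"
    unfolding N_def
  proof (clarsimp simp del: of_nat_Suc)
    fix a assume a: "a \<in> arcs G"
      and eq: "cone_rot k (\<gamma> a) (of_nat (Suc (f (head G a)))) = of_nat (Suc (f (tail G a)))"
    then have "norm (cone_rot k (\<gamma> a) (of_nat (Suc (f (head G a))))) = norm (of_nat (Suc (f (tail G a))) :: complex)"
      by simp
    then have "real (Suc (f (head G a))) = real (Suc (f (tail G a)))"
      unfolding cone_rot_def norm_mult norm_cis norm_of_nat by simp
    then have ht: "head G a = tail G a"
      using f by (simp add: inj_eq)
    have "cis (2 * pi * of_int (\<gamma> a) / real k) = 1"
      using eq unfolding ht cone_rot_def by (simp del: of_nat_Suc)
    moreover have "\<gamma> a \<in> {0..<int k}"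
      using assoc a k
      by (auto simp: associated_colored_graph_def colored_graph_def carrier_integer_mod_group)
    ultimately have g0: "\<gamma> a = 0"
      using cis_cone_neq_1[of "\<gamma> a" k] by fastforce
    have "group_action (integer_mod_group k) UNIV \<phi>"
      using graph by (simp add: free_symmetric_graph_def)
    from group_action.id_eq_one[OF this] have zero: "\<phi> 0 v = v" for v
      by (simp add: fun_eq_iff)
    have "edge_orbit k \<phi> {rep (tail G a), \<phi> (\<gamma> a) (rep (head G a))} \<in> edge_orbit k \<phi> ` E"
      using assoc a unfolding associated_colored_graph_def bij_betw_def by blast
    then obtain e where e: "e \<in> E" "edge_orbit k \<phi> {rep (head G a)} = edge_orbit k \<phi> e"
      by (auto simp: g0 zero ht)
    have "e \<in> edge_orbit k \<phi> e"
      unfolding edge_orbit_def Group_Action.orbit_def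
      by (auto simp: zero intro!: exI[of _ 0])
    then have "e \<in> edge_orbit k \<phi> {rep (head G a)}" by (simp add: e)
    then obtain g where "e = {\<phi> g (rep (head G a))}"
      by (auto simp: edge_orbit_def Group_Action.orbit_def)
    then show False
      using graph e by (auto simp: free_symmetric_graph_def)
  qed
  then have ne: "jacobian_rank k G \<gamma> ` N \<noteq> {}" by blast
  have "jacobian_rank k G \<gamma> ` N \<subseteq> {..DIM(real ^ 'e)}"
    by (auto simp: jacobian_rank_def simp del: DIM_cart intro: dim_subset_UNIV)
  then have fin: "finite (jacobian_rank k G \<gamma> ` N)"
    using finite_subset by blast
  obtain r where r: "r \<in> N" "jacobian_rank k G \<gamma> r = Max (jacobian_rank k G \<gamma> ` N)"
    using Max_in[OF fin ne] by auto
  obtain l p where lp: "cone_framework k \<phi> E l" "p \<in> realizations k \<phi> E l"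
      "restrict_to_reps rep p = r"
    using ex_realization_over_reps[OF k graph assoc, of r] r by (auto simp: N_def)
  have "jacobian_rank k G \<gamma> (restrict_to_reps rep' q) \<le> jacobian_rank k G \<gamma> r"
    if "cone_framework k \<phi>' E' l'" "associated_colored_graph k \<phi>' E' rep' G \<gamma>"
      "q \<in> realizations k \<phi>' E' l'"
    for \<phi>' :: "int \<Rightarrow> 'v \<Rightarrow> 'v" and E' l' rep' q
  proof -
    have "restrict_to_reps rep' q \<in> N"
      using realization_arc_nonzero(1)[OF k that] by (auto simp: N_def)
    then show ?thesis using fin r by simp
  qed
  then have "generic_realization k \<phi> E l rep G \<gamma> p"
    using lp unfolding generic_realization_def by blast
  then show ?thesis
    using lp by blast
qed

end

(*
Infinitesimal motions are governed by the linear maps q |-> R^gamma q_j - q_i, one for each arc;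
the functions on which all of them vanish are flat sections, of dimension sum T(C).  If the rows of
the Jacobian are independent, the flat sections of a subgraph together with the rotation give the
cone-Laman count.  Conversely, for a cone-Laman graph the count with one arc doubled is exactly the
Rado condition for choosing one direction per arc so that the direction network with any one arc
doubled has only the zero solution; a non-zero solution of the direction network itself is then a
realization without collapsed arcs whose Jacobian has rank 2 n - 1.  Finally a realization of locally
maximal rank is rigid iff the rank is 2 n - 1: for full rank one compares the quadratic length map
with its linear part transversally to the rotation orbit, and for smaller rank the inverse function
theorem gives a motion that is not a rotation.
*)
theory Submission
  imports Defs
begin

section \<open>Linear algebra\<close>

text \<open>Genericity compares Jacobian ranks only among realizations, hence among tuples of
  representatives without collapsed arcs. These tuples form an open set, so a generic rank is
  locally maximal, which is what a constant rank argument needs. The obstacle in the converse is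
  collapse. One direction per arc gives \<open>2 * n - 1\<close> linear equations in
  \<open>2 * n\<close> unknowns, so a non-zero solution comes for free, but an arc that it collapses
  has a zero row in the Jacobian. Doubling an arc rules out its collapse, and the same directions
  must work for every choice of the doubled arc. Rado's theorem applied to each choice separately
  would give unrelated directions; therefore directions are fixed arc by arc, each from a
  one-parameter family in which every doubled arc forbids at most one parameter. Minimality needs
  non-rigidity after deleting an arc, at a tuple chosen for the full graph. With independent rows
  that tuple still has one independent row per remaining arc, the largest rank possible for the
  smaller graph.\<close>

lemma dim_range_kernel:
  fixes f :: "'a::euclidean_space \<Rightarrow> 'b::euclidean_space"
  assumes "linear f"
  shows "dim (range f) + dim {x. f x = 0} = DIM('a)"
proof -
  define K where "K = {x. f x = 0}"
  define C where "C = {y \<in> UNIV. \<forall>x\<in>K. orthogonal x y}"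
  have subK: "subspace K"
    unfolding K_def by (rule linear_subspace_kernel[OF assms])
  have subC: "subspace C"
    unfolding C_def by (auto simp: subspace_def orthogonal_clauses)
  have dimC: "dim C + dim K = DIM('a)"
    unfolding C_def using dim_subspace_orthogonal_to_vectors[OF subK subspace_UNIV] by simp
  have "f ` C = range f"
  proof
    show "range f \<subseteq> f ` C"
    proof clarify
      fix x
      obtain y z where "y \<in> span K" "\<And>w. w \<in> span K \<Longrightarrow> orthogonal z w" "x = y + z"
        using orthogonal_subspace_decomp_exists by blast
      then have "y \<in> K" "z \<in> C"
        using subK by (metis span_eq_iff, simp add: C_def orthogonal_commute span_base)
      then have "f x = f z"
        using \<open>x = y + z\<close> assms by (simp add: K_def linear_add)
      then show "f x \<in> f ` C"
        using \<open>z \<in> C\<close> by blast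
    qed
  qed auto
  moreover have "inj_on f C"
  proof -
    have "x = y" if "x \<in> C" "y \<in> C" "f x = f y" for x y
    proof -
      have "x - y \<in> K" "x - y \<in> C"
        using that assms subC by (auto simp: K_def linear_diff subspace_diff)
      then show ?thesis
        by (auto simp: C_def orthogonal_self)
    qed
    then show ?thesis
      by (auto intro: inj_onI)
  qed
  then have "dim (f ` C) = dim C"
    using assms subC by (intro dim_image_eq) (metis span_eq_iff)+
  ultimately show ?thesis
    using dimC by (simp add: K_def)
qed

lemma dim_annihilator:
  fixes A :: "'a::euclidean_space set"
  shows "dim A + dim {y. \<forall>x\<in>A. x \<bullet> y = 0} = DIM('a)"
proof -
  have "{y. \<forall>x\<in>A. x \<bullet> y = 0} = {y \<in> UNIV. \<forall>x\<in>span A. orthogonal x y}"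
    using orthogonal_to_span by (fastforce simp: orthogonal_def inner_commute span_base)
  then show ?thesis
    using dim_subspace_orthogonal_to_vectors[of "span A" UNIV] by simp
qed

text \<open>The modular law for subspaces, weakened to any \<open>R\<close> inside the intersection
  of the spans because uncrossing only provides common generators.\<close>

lemma dim_submodular:
  fixes P Q R :: "'a::euclidean_space set"
  assumes "R \<subseteq> span P \<inter> span Q"
  shows "dim (P \<union> Q) + dim R \<le> dim P + dim Q"
proof -
  have "dim (span (P \<union> Q)) + dim (span P \<inter> span Q) = dim (span P) + dim (span Q)"
    unfolding span_Un by (rule dim_sums_Int[OF subspace_span subspace_span])
  then have "dim (P \<union> Q) + dim (span P \<inter> span Q) = dim P + dim Q"
    unfolding dim_span .
  then show ?thesis
    using dim_subset[OF assms] by linarith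
qed

text \<open>
  This is the inductive step of Rado's theorem on independent transversals, in a form that shows
  that almost every choice preserves the rank condition, and hence works for several weights at
  once.
\<close>

lemma rado_step:
  fixes Y :: "'i \<Rightarrow> 'a::euclidean_space set" and w :: "'i \<Rightarrow> nat"
  assumes fin: "finite A" and a: "a \<in> A" "w a = 1"
    and rank: "\<And>F. F \<subseteq> A \<Longrightarrow> sum w F \<le> dim (\<Union>b\<in>F. Y b)"
    and Ya: "Y a \<subseteq> span {u + x *\<^sub>R v, u + y *\<^sub>R v}"
  shows "(\<forall>F\<subseteq>A - {a}. sum w F < dim (insert (u + x *\<^sub>R v) (\<Union>b\<in>F. Y b)))
       \<or> (\<forall>F\<subseteq>A - {a}. sum w F < dim (insert (u + y *\<^sub>R v) (\<Union>b\<in>F. Y b)))"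
proof (rule ccontr)
  define U where "U F = (\<Union>b\<in>F. Y b)" for F
  assume "\<not> ?thesis"
  then obtain F1 F2 where
    F1: "F1 \<subseteq> A - {a}" "dim (insert (u + x *\<^sub>R v) (U F1)) \<le> sum w F1" and
    F2: "F2 \<subseteq> A - {a}" "dim (insert (u + y *\<^sub>R v) (U F2)) \<le> sum w F2"
    unfolding U_def de_Morgan_disj not_all not_imp not_less by (elim conjE exE) auto
  let ?P = "insert (u + x *\<^sub>R v) (U F1)" and ?Q = "insert (u + y *\<^sub>R v) (U F2)"
  have finF: "finite F1" "finite F2"
    using F1 F2 fin by (auto intro: finite_subset)
  \<comment> \<open>Uncrossing of two violating sets: \<open>?P\<close> and \<open>?Q\<close>
    together contain both candidate vectors and so span \<open>Y a\<close>. The rank condition for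
    \<open>insert a (F1 \<union> F2)\<close> gains the weight 1 of \<open>a\<close>, and adding the
    condition for \<open>F1 \<inter> F2\<close> contradicts submodularity.\<close>
  have "sum w (F1 \<inter> F2) \<le> dim (U (F1 \<inter> F2))"
    unfolding U_def using F1 by (intro rank) auto
  moreover have "sum w (insert a (F1 \<union> F2)) \<le> dim (?P \<union> ?Q)"
  proof -
    have "U (insert a (F1 \<union> F2)) \<subseteq> span (?P \<union> ?Q)"
    proof -
      have "span {u + x *\<^sub>R v, u + y *\<^sub>R v} \<subseteq> span (?P \<union> ?Q)"
        by (rule span_mono) simp
      moreover have "U F1 \<union> U F2 \<subseteq> span (?P \<union> ?Q)"
        using span_superset[of "?P \<union> ?Q"] by blast
      moreover have "U (insert a (F1 \<union> F2)) = Y a \<union> (U F1 \<union> U F2)"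
        unfolding U_def by blast
      ultimately show ?thesis
        using Ya by blast
    qed
    then have "dim (U (insert a (F1 \<union> F2))) \<le> dim (?P \<union> ?Q)"
      by (metis dim_span dim_subset)
    moreover have "sum w (insert a (F1 \<union> F2)) \<le> dim (U (insert a (F1 \<union> F2)))"
      unfolding U_def using F1 F2 a by (intro rank) auto
    ultimately show ?thesis by simp
  qed
  moreover have "sum w (insert a (F1 \<union> F2)) = 1 + sum w (F1 \<union> F2)"
    using F1 F2 finF a by (subst sum.insert) auto
  moreover have "dim (?P \<union> ?Q) + dim (U (F1 \<inter> F2)) \<le> dim ?P + dim ?Q"
    proof (rule dim_submodular)
    have "U (F1 \<inter> F2) \<subseteq> ?P" "U (F1 \<inter> F2) \<subseteq> ?Q"
      unfolding U_def by blast+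
    then show "U (F1 \<inter> F2) \<subseteq> span ?P \<inter> span ?Q"
      using span_superset[of ?P] span_superset[of ?Q] by blast
  qed
  moreover have "sum w (F1 \<union> F2) + sum w (F1 \<inter> F2) = sum w F1 + sum w F2"
    using finF by (rule sum.union_inter)
  ultimately show False
    using F1 F2 by linarith
qed

lemma dim_image_le_card:
  fixes f :: "'i \<Rightarrow> 'a::euclidean_space"
  assumes "finite A"
  shows "dim (f ` A) \<le> card A"
  using assms by (meson card_image_le dim_le_card' finite_imageI le_trans)

text \<open>Vectors are counted by index, so a repeated vector is a dependence. If no index were
  redundant, \<open>r\<close> would be injective on \<open>A\<close> with independent image, which
  forces dimension \<open>card A\<close>.\<close>

lemma dim_span_redundant:
  fixes r :: "'i \<Rightarrow> 'a::euclidean_space"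
  assumes "finite A" "dim (r ` A) < card A"
  obtains a where "a \<in> A" "dim (r ` (A - {a})) = dim (r ` A)"
proof -
  have "\<exists>a\<in>A. r a \<in> span (r ` (A - {a}))"
  proof (rule ccontr)
    assume *: "\<not> ?thesis"
    then have inj: "inj_on r A"
      by (intro inj_onI) (metis Diff_iff image_eqI insertE span_base empty_iff)
    have "independent (r ` A)"
      unfolding dependent_def
    proof clarify
      fix a assume "a \<in> A" "r a \<in> span (r ` A - {r a})"
      moreover have "r ` A - {r a} \<subseteq> r ` (A - {a})" by blast
      ultimately show False
        using * span_mono by blast
    qed
    then have "dim (r ` A) = card A"
      using inj by (simp add: dim_eq_card_independent card_image)
    then show False using assms by simp
  qed
  then obtain a where a: "a \<in> A" "r a \<in> span (r ` (A - {a}))" by blast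
  then have "span (r ` A) = span (r ` (A - {a}))"
    by (metis image_insert insert_Diff span_redundant)
  then have "dim (r ` (A - {a})) = dim (r ` A)"
    by (metis dim_span)
  then show ?thesis using that a by blast
qed

text \<open>\<open>B\<close> and its complement in \<open>A\<close> contribute at most their
  cardinalities, which add up to the dimension attained, so neither can fall short.\<close>

lemma dim_subset_full_rank:
  fixes r :: "'i \<Rightarrow> 'a::euclidean_space"
  assumes "finite A" "dim (r ` A) = card A" "B \<subseteq> A"
  shows "dim (r ` B) = card B"
proof -
  have fin: "finite (A - B)" "finite B" using assms by (auto intro: finite_subset)
  have "dim (r ` B \<union> r ` (A - B)) + dim ({} :: 'a set) \<le> dim (r ` B) + dim (r ` (A - B))"
    by (rule dim_submodular) auto
  moreover have "r ` B \<union> r ` (A - B) = r ` A" using assms by auto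
  moreover have "dim (r ` B) \<le> card B" "dim (r ` (A - B)) \<le> card (A - B)"
    using fin by (simp_all add: dim_image_le_card)
  moreover have "card A = card B + card (A - B)"
    using assms by (metis card_Diff_subset card_mono le_add_diff_inverse finite_subset)
  ultimately show ?thesis
    using assms by simp
qed

section \<open>A constant rank theorem\<close>

text \<open>With \<open>A'\<close> the adjoint of the derivative at \<open>p\<close> and
  \<open>\<pi>\<close> the orthogonal projection onto its kernel, \<open>A' o f + \<pi>\<close> is a
  local diffeomorphism at \<open>p\<close>, and \<open>q\<close> is the preimage of a small shift
  along \<open>\<kappa>\<close>. The conclusion keeps only the kernel component of
  \<open>q - p\<close>, which suffices to separate \<open>q\<close> from rotated copies of
  \<open>p\<close>.\<close>

lemma constant_rank_fibre:
  fixes f :: "'a::euclidean_space \<Rightarrow> 'b::euclidean_space" and J :: "'a \<Rightarrow> 'a \<Rightarrow>\<^sub>L 'b"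
  assumes U: "open U" "p \<in> U"
    and der: "\<And>x. x \<in> U \<Longrightarrow> (f has_derivative blinfun_apply (J x)) (at x)"
    and cont: "continuous_on U J"
    and rank: "\<And>x. x \<in> U \<Longrightarrow> dim (range (blinfun_apply (J x))) \<le> dim (range (blinfun_apply (J p)))"
    and kappa: "blinfun_apply (J p) \<kappa> = 0"
    and e: "e > 0"
  obtains q t where "dist q p < e" "f q = f p" "t \<noteq> 0"
    "\<And>y. blinfun_apply (J p) y = 0 \<Longrightarrow> (q - p) \<bullet> y = t * (\<kappa> \<bullet> y)"
proof -
  let ?A = "blinfun_apply (J p)"
  define K where "K = {x. ?A x = 0}"
  have lin: "linear (blinfun_apply (J x))" for x
    by (rule bounded_linear.linear[OF blinfun.bounded_linear_right])
  have subK: "subspace K"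
    unfolding K_def by (rule linear_subspace_kernel[OF lin])
  obtain B where B: "B \<subseteq> K" "pairwise orthogonal B" "\<And>x. x \<in> B \<Longrightarrow> norm x = 1"
      "independent B" "span B = K"
    using orthonormal_basis_subspace[OF subK] by metis
  have finB: "finite B" using B(4) by (rule independent_imp_finite)
  define \<pi> where "\<pi> x = (\<Sum>b\<in>B. (x \<bullet> b) *\<^sub>R b)" for x
  have lin_pi: "linear \<pi>"
    by (rule linearI)
      (simp_all add: \<pi>_def inner_left_distrib scaleR_left_distrib sum.distrib scaleR_sum_right)
  have pi_K: "\<pi> x \<in> K" for x
    unfolding \<pi>_def using B(1) subK by (intro subspace_sum subspace_scale) auto
  have pi_id: "\<pi> x = x" if "x \<in> K" for x
    unfolding \<pi>_def using orthonormal_basis_expand[OF B(2,3) _ finB] that B(5) by simp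
  have pi_inner: "\<pi> x \<bullet> y = x \<bullet> \<pi> y" for x y
    by (simp add: \<pi>_def inner_sum_left inner_sum_right mult.commute inner_commute)
  define A' where "A' = adjoint ?A"
  have adj: "x \<bullet> A' y = ?A x \<bullet> y" for x y
    unfolding A'_def by (rule adjoint_works[OF lin])
  have bl: "bounded_linear A'" "bounded_linear \<pi>"
    using lin_pi adjoint_linear[OF lin] by (simp_all add: A'_def linear_conv_bounded_linear)
  \<comment> \<open>The range of the adjoint is orthogonal to the kernel, so an equation between an
    element of that range and an element of \<open>K\<close> makes both sides vanish.\<close>
  have A'_K: "v = 0" if "v = A' w" "v \<in> K" for v w
  proof -
    have "v \<bullet> v = ?A v \<bullet> w" using adj[of v w] that by simp
    then show ?thesis using that by (simp add: K_def)
  qed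
  define \<Phi> where "\<Phi> x = A' (f x) + \<pi> x" for x
  define \<Phi>' where "\<Phi>' x = (Blinfun A' o\<^sub>L J x) + Blinfun \<pi>" for x
  have Phi'_apply: "blinfun_apply (\<Phi>' x) v = A' (blinfun_apply (J x) v) + \<pi> v" for x v
    by (simp add: \<Phi>'_def blinfun.add_left bounded_linear_Blinfun_apply[OF bl(1)]
        bounded_linear_Blinfun_apply[OF bl(2)])
  have der_Phi: "(\<Phi> has_derivative blinfun_apply (\<Phi>' x)) (at x)" if "x \<in> U" for x
    unfolding \<Phi>_def Phi'_apply[abs_def]
    by (intro has_derivative_add bounded_linear.has_derivative[OF bl(1)]
        bounded_linear.has_derivative[OF bl(2)] der[OF that] has_derivative_ident)
  have cont_Phi: "continuous_on U \<Phi>'"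
    unfolding \<Phi>'_def
    by (intro continuous_intros bounded_bilinear.continuous_on[OF bounded_bilinear_blinfun_compose] cont)
  have inj: "v = 0" if "blinfun_apply (\<Phi>' p) v = 0" for v
  proof -
    have "A' (?A v) = - \<pi> v"
      using that by (simp add: Phi'_apply eq_neg_iff_add_eq_0)
    moreover have "- \<pi> v \<in> K" using pi_K subK by (simp add: subspace_neg)
    ultimately have "- \<pi> v = 0" using A'_K[of "- \<pi> v" "?A v"] by simp
    then have "\<pi> v = 0" "A' (?A v) = 0" using \<open>A' (?A v) = - \<pi> v\<close> by simp_all
    then have "v \<in> K"
      using adj[of v "?A v"] by (simp add: K_def)
    then show "v = 0" using pi_id \<open>\<pi> v = 0\<close> by simp
  qed
  have "linear (blinfun_apply (\<Phi>' p))" by (rule bounded_linear.linear[OF blinfun.bounded_linear_right])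
  moreover have "inj (blinfun_apply (\<Phi>' p))"
    using linear_inj_iff_eq_0[OF \<open>linear (blinfun_apply (\<Phi>' p))\<close>] inj by blast
  ultimately obtain h where h: "linear h" "h \<circ> blinfun_apply (\<Phi>' p) = id"
    using linear_injective_left_inverse by blast
  then have "Blinfun h o\<^sub>L \<Phi>' p = id_blinfun"
    by (intro blinfun_eqI)
      (simp add: bounded_linear_Blinfun_apply linear_conv_bounded_linear[symmetric] fun_eq_iff)
  from inverse_function_theorem[OF U(1) der_Phi cont_Phi U(2) this]
  obtain U' V g g' where inv: "open U'" "U' \<subseteq> U" "p \<in> U'" "open V" "\<Phi> p \<in> V" "homeomorphism U' V \<Phi> g"
      "\<And>y. y \<in> V \<Longrightarrow> (g has_derivative (g' y)) (at y)"
      "\<And>y. y \<in> V \<Longrightarrow> g' y = inv_into UNIV (blinfun_apply (\<Phi>' (g y)))"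
      "\<And>y. y \<in> V \<Longrightarrow> bij (blinfun_apply (\<Phi>' (g y)))"
    by metis
  have gU: "g y \<in> U'" "\<Phi> (g y) = y" if "y \<in> V" for y
    using inv(6) that by (auto simp: homeomorphism_def)
  have g_p: "g (\<Phi> p) = p"
    using inv(3,6) by (auto simp: homeomorphism_def)
  \<comment> \<open>Invertibility of \<open>\<Phi>' x\<close> makes \<open>\<pi>\<close> injective
    on the kernel of \<open>A' o J x\<close>, which therefore has dimension at most
    \<open>dim K\<close>. By the rank bound the kernel of \<open>J x\<close>, contained in it, is at
    least that large, so the two kernels agree.\<close>
  have ker: "blinfun_apply (J x) v = 0"
    if x: "x \<in> U" "bij (blinfun_apply (\<Phi>' x))" and v: "A' (blinfun_apply (J x) v) = 0" for x v
  proof -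
    let ?M = "{v. A' (blinfun_apply (J x) v) = 0}" and ?N = "{v. blinfun_apply (J x) v = 0}"
    have linM: "linear (\<lambda>v. A' (blinfun_apply (J x) v))"
      using linear_compose[OF lin adjoint_linear[OF lin]] by (simp add: o_def A'_def)
    have subM: "subspace ?M" "subspace ?N"
      by (rule linear_subspace_kernel[OF linM]) (rule linear_subspace_kernel[OF lin])
    have "inj_on \<pi> ?M"
    proof (rule inj_onI)
      fix a b assume "a \<in> ?M" "b \<in> ?M" "\<pi> a = \<pi> b"
      then have "blinfun_apply (\<Phi>' x) a = blinfun_apply (\<Phi>' x) b" by (simp add: Phi'_apply)
      then show "a = b" using x(2) by (auto simp: bij_def dest: injD)
    qed
    then have "dim ?M = dim (\<pi> ` ?M)"
      using dim_image_eq[OF lin_pi, of ?M] subM by (metis span_eq_iff)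
    also have "\<dots> \<le> dim K"
      using pi_K by (intro dim_subset) auto
    also have "\<dots> \<le> dim ?N"
      using rank[OF x(1)] dim_range_kernel[OF lin, of x] dim_range_kernel[OF lin, of p]
      by (simp add: K_def)
    finally have "?N = ?M"
      using subM by (intro subspace_dim_equal) (auto simp: A'_def linear_0[OF adjoint_linear[OF lin]])
    then show ?thesis using v by blast
  qed
  obtain d1 where d1: "d1 > 0" "ball (\<Phi> p) d1 \<subseteq> V"
    using inv(4,5) by (meson openE)
  have "isCont g (\<Phi> p)"
    using inv(5,7) has_derivative_continuous by blast
  then obtain d2 where d2: "d2 > 0" "\<And>y. dist y (\<Phi> p) < d2 \<Longrightarrow> dist (g y) (g (\<Phi> p)) < e"
    using e unfolding continuous_at_eps_delta by metis
  \<comment> \<open>The factor 2 keeps the segment strictly inside both radii; the summand 1 covers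
    \<open>\<kappa> = 0\<close>.\<close>
  define t where "t = min d1 d2 / (2 * (norm \<kappa> + 1))"
  have pos: "norm \<kappa> + 1 > 0" by (simp add: add_nonneg_pos)
  have t: "t > 0" unfolding t_def using d1 d2 pos by simp
  have t_small: "s * norm \<kappa> < min d1 d2" if "s \<in> {0..t}" for s
  proof -
    have "s * norm \<kappa> \<le> t * (norm \<kappa> + 1)"
      using that t by (intro mult_mono) auto
    also have "\<dots> = min d1 d2 / 2" unfolding t_def using pos by (simp add: field_simps)
    also have "\<dots> < min d1 d2" using d1 d2 by linarith
    finally show ?thesis .
  qed
  define l where "l s = \<Phi> p + s *\<^sub>R \<kappa>" for s
  have dist_l: "dist (l s) (\<Phi> p) < min d1 d2" if "s \<in> {0..t}" for s
    using t_small[OF that] that by (simp add: l_def dist_norm)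
  have lV: "l s \<in> V" if "s \<in> {0..t}" for s
    using dist_l[OF that] d1 by (auto simp: dist_commute)
  have "((f \<circ> g \<circ> l) has_derivative (\<lambda>h. 0)) (at s within {0..t})" if s: "s \<in> {0..t}" for s
  proof -
    let ?x = "g (l s)"
    have xU: "?x \<in> U" using gU[OF lV[OF s]] inv(2) by blast
    define v where "v = g' (l s) \<kappa>"
    have "blinfun_apply (\<Phi>' ?x) v = \<kappa>"
      unfolding v_def inv(8)[OF lV[OF s]] using inv(9)[OF lV[OF s]]
      by (simp add: bij_is_surj surj_f_inv_f)
    \<comment> \<open>Here \<open>v\<close> is the velocity of the curve. The left side lies in the
      range of \<open>A'\<close>, the right side in \<open>K\<close>, so both vanish; then
      \<open>J ?x\<close> annihilates \<open>v\<close>, and \<open>f\<close> is constant along the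
      curve.\<close>
    then have "A' (blinfun_apply (J ?x) v) = \<kappa> - \<pi> v"
      by (simp add: Phi'_apply algebra_simps)
    moreover have "\<kappa> - \<pi> v \<in> K"
      using subspace_diff[OF subK _ pi_K] kappa by (simp add: K_def)
    ultimately have "A' (blinfun_apply (J ?x) v) = 0" using A'_K by metis
    then have Jv: "blinfun_apply (J ?x) v = 0"
      using ker[OF xU inv(9)[OF lV[OF s]]] by blast
    have "(l has_derivative (\<lambda>h. h *\<^sub>R \<kappa>)) (at s within {0..t})"
      unfolding l_def by (auto intro!: derivative_eq_intros)
    moreover have "((\<lambda>y. f (g y)) has_derivative (\<lambda>h. blinfun_apply (J ?x) (g' (l s) h))) (at (l s))"
      using has_derivative_compose[OF inv(7)[OF lV[OF s]] der[OF xU]] .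
    ultimately have "((\<lambda>r. f (g (l r))) has_derivative (\<lambda>h. blinfun_apply (J ?x) (g' (l s) (h *\<^sub>R \<kappa>))))
        (at s within {0..t})"
      by (rule has_derivative_compose)
    moreover have "g' (l s) (h *\<^sub>R \<kappa>) = h *\<^sub>R v" for h
      using linear_scale[OF has_derivative_linear[OF inv(7)[OF lV[OF s]]]] by (simp add: v_def)
    ultimately show ?thesis
      using Jv by (simp add: o_def blinfun.scaleR_right)
  qed
  then obtain c where "\<And>s. s \<in> {0..t} \<Longrightarrow> (f \<circ> g \<circ> l) s = c"
    using has_derivative_zero_constant[of "{0..t}" "f \<circ> g \<circ> l"] by auto
  from this[of t] this[of 0] have fq: "f (g (l t)) = f p"
    using t g_p by (simp add: l_def)
  have tt: "t \<in> {0..t}" using t by simp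
  have "\<Phi> (g (l t)) = \<Phi> p + t *\<^sub>R \<kappa>" using gU[OF lV[OF tt]] by (simp add: l_def)
  then have pi_q: "\<pi> (g (l t) - p) = t *\<^sub>R \<kappa>"
    unfolding \<Phi>_def fq linear_diff[OF lin_pi] by (simp add: algebra_simps)
  have "(g (l t) - p) \<bullet> y = t * (\<kappa> \<bullet> y)" if "?A y = 0" for y
  proof -
    have "(g (l t) - p) \<bullet> y = (g (l t) - p) \<bullet> \<pi> y"
      using pi_id[of y] that by (simp add: K_def)
    also have "\<dots> = t * (\<kappa> \<bullet> y)"
      using pi_inner[of "g (l t) - p" y] by (simp add: pi_q)
    finally show ?thesis .
  qed
  moreover have "dist (g (l t)) p < e"
    using d2(2)[of "l t"] dist_l[OF tt] g_p by simp
  ultimately show ?thesis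
    using that[of "g (l t)" t] fq t by simp
qed

section \<open>Flat sections of colored graphs\<close>

definition arc_vec :: "nat \<Rightarrow> ('w::finite, 'e) pre_digraph \<Rightarrow> ('e \<Rightarrow> int) \<Rightarrow> 'e \<Rightarrow> complex ^ 'w \<Rightarrow> complex"
  where "arc_vec k G \<gamma> a q = cone_rot k (\<gamma> a) (q $ head G a) - q $ tail G a"

text \<open>These are the global sections of the local system on \<open>H\<close> with the plane as
  fibre and the colors as monodromy. Coordinates off \<open>verts H\<close> are pinned to 0, so all
  subgraphs share an ambient space, while an isolated vertex of \<open>H\<close> keeps its
  plane.\<close>

definition flat_sections :: "nat \<Rightarrow> ('w::finite, 'e) pre_digraph \<Rightarrow> ('e \<Rightarrow> int) \<Rightarrow> (complex ^ 'w) set"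
  where "flat_sections k H \<gamma> =
     {q. (\<forall>i. i \<notin> verts H \<longrightarrow> q $ i = 0) \<and> (\<forall>a\<in>arcs H. arc_vec k H \<gamma> a q = 0)}"

lemma linear_arc_vec: "linear (arc_vec k G \<gamma> a)"
  by (rule linearI) (simp_all add: arc_vec_def cone_rot_def algebra_simps scaleR_conv_of_real[where 'a=complex])

lemma arc_vec_scale: "arc_vec k G \<gamma> a (\<chi> i. c * q $ i) = c * arc_vec k G \<gamma> a q"
  by (simp add: arc_vec_def cone_rot_def algebra_simps)

lemma arc_vec_subgraph: "subgraph H G \<Longrightarrow> arc_vec k H \<gamma> = arc_vec k G \<gamma>"
  by (simp add: fun_eq_iff arc_vec_def subgraph_def compatible_def)

lemma subspace_flat_sections: "subspace (flat_sections k H \<gamma>)"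
  unfolding flat_sections_def
  by (auto simp: subspace_def arc_vec_def cone_rot_def algebra_simps scaleR_conv_of_real[where 'a=complex])

subsection \<open>Path colors\<close>

definition reverse_path :: "('b \<times> bool) list \<Rightarrow> ('b \<times> bool) list"
  where "reverse_path P = rev (map (\<lambda>(a, b). (a, \<not> b)) P)"

lemma reverse_path_simps [simp]:
  "reverse_path [] = []" "reverse_path (s # P) = reverse_path P @ [(fst s, \<not> snd s)]"
  by (auto simp: reverse_path_def split: prod.splits)

lemma colored_path_append:
  "colored_path G u P v \<Longrightarrow> colored_path G v Q w \<Longrightarrow> colored_path G u (P @ Q) w"
  by (induction P arbitrary: u) auto

lemma colored_path_verts:
  assumes "wf_digraph G" "colored_path G u P v"
  shows "u \<in> verts G" "v \<in> verts G"
  using assms(2)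
proof (induction P arbitrary: u)
  case (Cons s P)
  {
    case 1
    then show ?case
      using assms(1) by (auto simp: wf_digraph_def split: if_splits)
  next
    case 2
    then show ?case using Cons by auto
  }
qed auto

lemma colored_path_reverse:
  assumes "wf_digraph G" "colored_path G u P v"
  shows "colored_path G v (reverse_path P) u"
  using assms(2)
proof (induction P arbitrary: u)
  case (Cons s P)
  let ?m = "if snd s then head G (fst s) else tail G (fst s)"
  have "colored_path G v (reverse_path P) ?m" using Cons by simp
  moreover have "colored_path G ?m [(fst s, \<not> snd s)] u"
    using Cons.prems assms(1) by (auto simp: wf_digraph_def)
  ultimately show ?case
    using colored_path_append by fastforce
qed simp

locale cone_colored_graph =
  fixes k :: nat and G :: "('w::finite, 'e) pre_digraph" and \<gamma> :: "'e \<Rightarrow> int"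
  assumes k_pos: "k > 0" and colored: "colored_graph k G \<gamma>"
begin

lemma wf: "wf_digraph G"
  using colored by (simp add: colored_graph_def fin_digraph_def)

lemma color_range: "a \<in> arcs G \<Longrightarrow> \<gamma> a \<in> {0..<int k}"
  using colored k_pos by (auto simp: colored_graph_def carrier_integer_mod_group)

lemma path_color_range: "path_color k \<gamma> P \<in> {0..<int k}"
  using k_pos by (cases P) auto

lemma rot_zero: "cone_rot k 0 z = z"
  by (simp add: cone_rot_def)

lemma rot_neg: "cone_rot k ((- g) mod int k) (cone_rot k g z) = z"
  using cone_rot_add[OF k_pos, of "(- g) mod int k" g z] by (simp add: mod_simps rot_zero)

lemma rot_step:
  assumes "fst s \<in> arcs G"
  shows "cone_rot k (path_color k \<gamma> (s # P)) z =
     cone_rot k (if snd s then \<gamma> (fst s) else (- \<gamma> (fst s)) mod int k) (cone_rot k (path_color k \<gamma> P) z)"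
  using cone_rot_add[OF k_pos] color_range[OF assms] k_pos
  by (simp add: carrier_integer_mod_group)

lemma rot_append:
  assumes "colored_path G u P v"
  shows "cone_rot k (path_color k \<gamma> (P @ Q)) z =
     cone_rot k (path_color k \<gamma> P) (cone_rot k (path_color k \<gamma> Q) z)"
  using assms
proof (induction P arbitrary: u)
  case Nil
  then show ?case by (simp add: rot_zero)
next
  case (Cons s P)
  then have "fst s \<in> arcs G" by simp
  then show ?case
    using Cons by (simp only: append_Cons rot_step) auto
qed

text \<open>Parallel transport: flatness on an arc determines the value at either end from the
  other.\<close>

lemma rot_path_flat:
  assumes "\<And>a. a \<in> arcs G \<Longrightarrow> arc_vec k G \<gamma> a q = 0" "colored_path G u P v"
  shows "q $ u = cone_rot k (path_color k \<gamma> P) (q $ v)"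
  using assms(2)
proof (induction P arbitrary: u)
  case Nil
  then show ?case by (simp add: rot_zero)
next
  case (Cons s P)
  then have a: "fst s \<in> arcs G" by simp
  then have flat: "cone_rot k (\<gamma> (fst s)) (q $ head G (fst s)) = q $ tail G (fst s)"
    using assms(1) by (simp add: arc_vec_def)
  have IH: "q $ (if snd s then head G (fst s) else tail G (fst s)) =
      cone_rot k (path_color k \<gamma> P) (q $ v)"
    using Cons by simp
  show ?case
  proof (cases "snd s")
    case True
    then show ?thesis
      using Cons.prems IH flat by (simp only: rot_step[OF a]) simp
  next
    case False
    then have "q $ u = cone_rot k ((- \<gamma> (fst s)) mod int k) (q $ tail G (fst s))"
      using Cons.prems flat rot_neg by (metis colored_path.simps(2))
    then show ?thesis
      using False IH by (simp only: rot_step[OF a]) simp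
  qed
qed

lemma rot_fixed_imp_zero:
  assumes "cone_rot k g z = z" "g \<in> {0..<int k}" "g \<noteq> 0"
  shows "z = 0"
  using assms cis_cone_neq_1[of g k] by (auto simp: cone_rot_def)

text \<open>
  Transport along paths identifies the flat sections of a connected graph with the vectors fixed by
  the rotations of all closed paths.
\<close>

lemma dim_flat_sections_connected:
  assumes ne: "verts G \<noteq> {}"
    and conn: "\<And>u v. u \<in> verts G \<Longrightarrow> v \<in> verts G \<Longrightarrow> \<exists>P. colored_path G u P v"
  shows "int (dim (flat_sections k G \<gamma>)) = T_number k \<gamma> G"
proof (cases "\<exists>u P. colored_path G u P u \<and> path_color k \<gamma> P \<noteq> 0")
  case True
  then obtain u P where P: "colored_path G u P u" "path_color k \<gamma> P \<noteq> 0" by blast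
  have "q = 0" if q: "q \<in> flat_sections k G \<gamma>" for q
  proof -
    have flat: "\<And>a. a \<in> arcs G \<Longrightarrow> arc_vec k G \<gamma> a q = 0"
      using q by (simp add: flat_sections_def)
    \<comment> \<open>A non-trivial rotation fixes only the origin, so a single closed path of
      non-trivial color kills every flat section; dimension 1 does not occur.\<close>
    have "q $ u = cone_rot k (path_color k \<gamma> P) (q $ u)"
      using rot_path_flat[OF flat P(1)] .
    then have u0: "q $ u = 0"
      using rot_fixed_imp_zero[OF _ path_color_range P(2)] by metis
    have "q $ v = 0" for v
    proof (cases "v \<in> verts G")
      case True
      then obtain Q where "colored_path G v Q u"
        using conn colored_path_verts[OF wf P(1)] by blast
      from rot_path_flat[OF flat this] show ?thesis
        by (simp add: u0 cone_rot_def)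
    next
      case False
      then show ?thesis using q by (simp add: flat_sections_def)
    qed
    then show ?thesis by (simp add: vec_eq_iff)
  qed
  then have "flat_sections k G \<gamma> = {0}"
    using subspace_0[OF subspace_flat_sections[of k G \<gamma>]] by auto
  then show ?thesis
    using True by (simp add: T_number_def)
next
  case False
  then have balanced: "path_color k \<gamma> P = 0" if "colored_path G u P u" for u P
    using that by blast
  obtain r where r: "r \<in> verts G" using ne by blast
  have "\<forall>v. \<exists>P. v \<in> verts G \<longrightarrow> colored_path G v P r"
    using conn r by blast
  then obtain P where P: "\<And>v. v \<in> verts G \<Longrightarrow> colored_path G v (P v) r"
    by metis
  define S where "S z = (\<chi> v. if v \<in> verts G then cone_rot k (path_color k \<gamma> (P v)) z else 0)"
    for z
  have linS: "linear S"
    by (rule linearI)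
      (auto simp: S_def vec_eq_iff cone_rot_def algebra_simps scaleR_conv_of_real[where 'a=complex])
  have Sr: "S z $ r = z" for z
    using balanced[OF P[OF r]] r by (simp add: S_def rot_zero)
  have "S z \<in> flat_sections k G \<gamma>" for z
    unfolding flat_sections_def
  proof (intro CollectI conjI ballI allI impI)
    fix a assume a: "a \<in> arcs G"
    then have ht: "head G a \<in> verts G" "tail G a \<in> verts G"
      using wf by (auto simp: wf_digraph_def)
    \<comment> \<open>The closed path from \<open>r\<close> back along \<open>P (tail G a)\<close>,
      over \<open>a\<close> and along \<open>P (head G a)\<close> has trivial color, so the paths
      chosen independently at the two ends of \<open>a\<close> transport consistently.\<close>
    have bwd: "colored_path G r (reverse_path (P (tail G a))) (tail G a)"
      by (rule colored_path_reverse[OF wf P[OF ht(2)]])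
    have step: "colored_path G (tail G a) ((a, True) # P (head G a)) r"
      using a P[OF ht(1)] by simp
    have "cone_rot k (path_color k \<gamma> (P (tail G a)))
        (cone_rot k (path_color k \<gamma> (reverse_path (P (tail G a))))
          (cone_rot k (path_color k \<gamma> ((a, True) # P (head G a))) z)) =
        cone_rot k (path_color k \<gamma> (P (tail G a))) z"
      using balanced[OF colored_path_append[OF bwd step]] rot_append[OF bwd] rot_zero by metis
    moreover have "cone_rot k (path_color k \<gamma> (P (tail G a)))
        (cone_rot k (path_color k \<gamma> (reverse_path (P (tail G a)))) y) = y" for y
      using balanced[OF colored_path_append[OF P[OF ht(2)] bwd]] rot_append[OF P[OF ht(2)]] rot_zero
      by metis
    ultimately have "cone_rot k (path_color k \<gamma> ((a, True) # P (head G a))) z =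
        cone_rot k (path_color k \<gamma> (P (tail G a))) z" by simp
    then have "cone_rot k (\<gamma> a) (cone_rot k (path_color k \<gamma> (P (head G a))) z) =
        cone_rot k (path_color k \<gamma> (P (tail G a))) z"
      using rot_step[of "(a, True)"] a by simp
    then show "arc_vec k G \<gamma> a (S z) = 0"
      using ht by (simp add: arc_vec_def S_def)
  qed (simp add: S_def)
  moreover have "q = S (q $ r)" if q: "q \<in> flat_sections k G \<gamma>" for q
    using rot_path_flat[OF _ P] q by (auto simp: flat_sections_def S_def vec_eq_iff)
  ultimately have "flat_sections k G \<gamma> = range S" by blast
  moreover have "inj S"
    by (rule injI) (metis Sr)
  then have "dim (range S) = 2"
    using dim_image_eq[OF linS, of UNIV] by simp
  moreover have "T_number k \<gamma> G = 2"
    using False by (simp add: T_number_def)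
  ultimately show ?thesis by simp
qed

end

subsection \<open>Connected components\<close>

text \<open>Reachability in the symmetrised graph forgets which arc is crossed and in which
  direction. Colors depend on both, so each step is lifted to a marked arc.\<close>

lemma reachable_mk_symmetric_iff_path:
  assumes "wf_digraph H"
  shows "u \<rightarrow>\<^sup>*\<^bsub>with_proj (mk_symmetric H)\<^esub> v \<longleftrightarrow> (\<exists>P. colored_path H u P v)"
proof
  assume "u \<rightarrow>\<^sup>*\<^bsub>with_proj (mk_symmetric H)\<^esub> v"
  then have "(u, v) \<in> rtrancl_on (verts H) (parcs (mk_symmetric H))"
    by (simp add: reachable_def)
  then show "\<exists>P. colored_path H u P v"
  proof (induction rule: converse_rtrancl_on_induct)
    case base
    then show ?case by (intro exI[of _ "[]"]) simp
  next
    case (step x y)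
    then obtain P where P: "colored_path H y P v" by blast
    from step obtain a where "a \<in> arcs H"
      "(x = tail H a \<and> y = head H a) \<or> (x = head H a \<and> y = tail H a)"
      by (auto simp: parcs_mk_symmetric)
    then have "colored_path H x ((a, True) # P) v \<or> colored_path H x ((a, False) # P) v"
      using P by auto
    then show ?case by blast
  qed
next
  assume "\<exists>P. colored_path H u P v"
  then obtain P where "colored_path H u P v" by blast
  then have "(u, v) \<in> rtrancl_on (verts H) (parcs (mk_symmetric H))"
  proof (induction P arbitrary: u)
    case (Cons s P)
    let ?m = "if snd s then head H (fst s) else tail H (fst s)"
    have "(u, ?m) \<in> parcs (mk_symmetric H)" "u \<in> verts H"
      using Cons.prems assms by (auto simp: parcs_mk_symmetric wf_digraph_def split: if_splits)
    then show ?case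
      using Cons by (auto intro: converse_rtrancl_on_into_rtrancl_on)
  qed auto
  then show "u \<rightarrow>\<^sup>*\<^bsub>with_proj (mk_symmetric H)\<^esub> v"
    by (simp add: reachable_def)
qed

lemma connected_iff_path:
  assumes "wf_digraph H"
  shows "Digraph_Component.connected H \<longleftrightarrow>
     verts H \<noteq> {} \<and> (\<forall>u\<in>verts H. \<forall>v\<in>verts H. \<exists>P. colored_path H u P v)"
  by (simp add: Digraph_Component.connected_def strongly_connected_def
      reachable_mk_symmetric_iff_path[OF assms])

definition path_class :: "('a, 'b) pre_digraph \<Rightarrow> 'a \<Rightarrow> 'a set"
  where "path_class H u = {v. \<exists>P. colored_path H u P v}"

lemma path_class_arc:
  assumes "wf_digraph H" "a \<in> arcs H"
  shows "head H a \<in> path_class H u \<longleftrightarrow> tail H a \<in> path_class H u"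
proof -
  have "colored_path H (tail H a) [(a, True)] (head H a)"
    "colored_path H (head H a) [(a, False)] (tail H a)"
    using assms by (auto simp: wf_digraph_def)
  then show ?thesis
    unfolding path_class_def using colored_path_append by fastforce
qed

lemma path_class_eq:
  assumes "wf_digraph H" "v \<in> path_class H u"
  shows "path_class H v = path_class H u"
  using assms colored_path_append colored_path_reverse unfolding path_class_def by fast

lemma colored_path_subgraph:
  assumes "subgraph C H" "colored_path C u P v"
  shows "colored_path H u P v"
  using assms(2)
proof (induction P arbitrary: u)
  case Nil
  then show ?case using assms(1) by (auto simp: subgraph_def)
next
  case (Cons s P)
  have "tail C = tail H" "head C = head H" "arcs C \<subseteq> arcs H"
    using assms(1) by (auto simp: subgraph_def compatible_def)
  then show ?case
    using Cons.prems Cons.IH[of "if snd s then head C (fst s) else tail C (fst s)"] by auto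
qed

lemma colored_path_class:
  assumes wf: "wf_digraph H" and "colored_path H v P w" "v \<in> path_class H u"
  shows "colored_path (H \<restriction> path_class H u) v P w"
  using assms(2,3)
proof (induction P arbitrary: v)
  case (Cons s P)
  let ?m = "if snd s then head H (fst s) else tail H (fst s)"
  have "?m \<in> path_class H u"
    using Cons.prems path_class_arc[OF wf, of "fst s" u] by (auto split: if_splits)
  then show ?case
    using Cons path_class_arc[OF wf, of "fst s" u] by (auto split: if_splits)
qed auto

lemma path_class_subset: "wf_digraph H \<Longrightarrow> path_class H u \<subseteq> verts H"
  using colored_path_verts unfolding path_class_def by fast

text \<open>A path class is closed under arcs, so the subgraph it induces is connected and absorbs
  every connected subgraph that contains its base point. Maximality and uniqueness of components
  both come from this absorption.\<close>

lemma components_eq: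
  assumes wf: "wf_digraph H"
  shows "components H = (\<lambda>u. H \<restriction> path_class H u) ` verts H"
proof -
  let ?K = "\<lambda>u. H \<restriction> path_class H u"
  have self: "u \<in> path_class H u" if "u \<in> verts H" for u
    unfolding path_class_def using that by (auto intro!: exI[of _ "[]"])
  have wfK: "wf_digraph (?K u)" for u
    by (auto simp: wf_digraph_def)
  have subK: "subgraph (?K u) H" for u
    using wf wfK path_class_subset[OF wf] by (auto simp: subgraph_def compatible_def)
  have connK: "Digraph_Component.connected (?K u)" if "u \<in> verts H" for u
    unfolding connected_iff_path[OF wfK]
  proof (intro conjI ballI)
    show "verts (?K u) \<noteq> {}" using self[OF that] by auto
    fix v w assume "v \<in> verts (?K u)" "w \<in> verts (?K u)"
    then have vw: "v \<in> path_class H u" "w \<in> path_class H u" by auto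
    then have "w \<in> path_class H v"
      using path_class_eq[OF wf] by blast
    then show "\<exists>P. colored_path (?K u) v P w"
      using colored_path_class[OF wf _ vw(1)] by (auto simp: path_class_def)
  qed
  have inK: "subgraph C (?K u)"
    if C: "subgraph C H" "Digraph_Component.connected C" "u \<in> verts C" for C u
  proof -
    have wfC: "wf_digraph C" using C by (simp add: subgraph_def)
    have "verts C \<subseteq> path_class H u"
    proof
      fix v assume "v \<in> verts C"
      then obtain P where "colored_path C u P v"
        using C connected_iff_path[OF wfC] by blast
      then show "v \<in> path_class H u"
        using colored_path_subgraph[OF C(1)] by (auto simp: path_class_def)
    qed
    then show ?thesis
      using C wfC wfK by (auto simp: subgraph_def compatible_def wf_digraph_def)
  qed
  have max: "pre_digraph.max_subgraph H Digraph_Component.connected (?K u)" if u: "u \<in> verts H" for u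
    unfolding pre_digraph.max_subgraph_def
  proof (intro conjI allI impI notI)
    fix C assume C: "C \<noteq> ?K u \<and> subgraph (?K u) C" "subgraph C H \<and> Digraph_Component.connected C"
    then have "u \<in> verts C" using self[OF u] by (auto simp: subgraph_def)
    then have "subgraph C (?K u)" using inK C by blast
    then have "C = ?K u"
      using C by (intro pre_digraph.equality) (auto simp: subgraph_def compatible_def)
    then show False using C by blast
  qed (use subK connK u in auto)
  show ?thesis
  proof
    show "?K ` verts H \<subseteq> components H"
      using max by (auto simp: components_def)
    show "components H \<subseteq> ?K ` verts H"
    proof
      fix C assume "C \<in> components H"
      then have C: "subgraph C H" "Digraph_Component.connected C"
        "\<And>C'. C' \<noteq> C \<Longrightarrow> subgraph C C' \<Longrightarrow> subgraph C' H \<Longrightarrow> \<not> Digraph_Component.connected C'"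
        by (auto simp: components_def pre_digraph.max_subgraph_def)
      then have "wf_digraph C" by (simp add: subgraph_def)
      then obtain u where u: "u \<in> verts C" using C(2) by (auto simp: connected_iff_path)
      then have uH: "u \<in> verts H" using C(1) by (auto simp: subgraph_def)
      then have "?K u = C"
        using C inK[OF C(1,2) u] subK connK by metis
      then show "C \<in> ?K ` verts H" using uH by blast
    qed
  qed
qed

text \<open>No arc joins two components, so a flat section cut off to one of them stays flat. The
  sections form a direct sum over the components, each summand being the connected case.\<close>

lemma dim_flat_sections:
  fixes H :: "('w::finite, 'e) pre_digraph"
  assumes k: "k > 0" and col: "colored_graph k H \<gamma>"
  shows "int (dim (flat_sections k H \<gamma>)) = (\<Sum>C\<in>components H. T_number k \<gamma> C)"
proof -
  interpret H: cone_colored_graph k H \<gamma> by unfold_locales (use assms in auto)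
  let ?K = "\<lambda>u. H \<restriction> path_class H u"
  note wf = H.wf
  have dimK: "int (dim (flat_sections k (?K u) \<gamma>)) = T_number k \<gamma> (?K u)"
    if u: "u \<in> verts H" for u
  proof -
    have "wf_digraph (?K u)" by (auto simp: wf_digraph_def)
    then have K: "cone_colored_graph k (?K u) \<gamma>"
      using k col by unfold_locales
        (auto simp: colored_graph_def fin_digraph_def fin_digraph_axioms_def wf_digraph_def)
    have "u \<in> path_class H u"
      unfolding path_class_def using u by (auto intro!: exI[of _ "[]"])
    then have "verts (?K u) \<noteq> {}" by auto
    moreover have "\<exists>P. colored_path (?K u) v P w" if "v \<in> verts (?K u)" "w \<in> verts (?K u)" for v w
    proof -
      have vw: "v \<in> path_class H u" "w \<in> path_class H v"
        using that path_class_eq[OF wf] by auto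
      then show ?thesis
        using colored_path_class[OF wf _ vw(1)] by (auto simp: path_class_def)
    qed
    ultimately show ?thesis
      using cone_colored_graph.dim_flat_sections_connected[OF K] by blast
  qed
  define Z where "Z \<C> = {q \<in> flat_sections k H \<gamma>. \<forall>i. i \<notin> (\<Union>C\<in>\<C>. verts C) \<longrightarrow> q $ i = 0}"
    for \<C> :: "('w, 'e) pre_digraph set"
  have subZ: "subspace (Z \<C>)" for \<C>
    using subspace_flat_sections[of k H \<gamma>] by (auto simp: Z_def subspace_def)
  have flatK: "flat_sections k (?K u) \<gamma> = Z {?K u}" if u: "u \<in> verts H" for u
  proof (intro equalityI subsetI)
    fix q assume q: "q \<in> flat_sections k (?K u) \<gamma>"
    have "arc_vec k H \<gamma> a q = 0" if a: "a \<in> arcs H" for a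
    proof (cases "tail H a \<in> path_class H u")
      case True
      then show ?thesis
        using q a path_class_arc[OF wf a, of u] by (auto simp: flat_sections_def arc_vec_def)
    next
      case False
      then show ?thesis
        using q a path_class_arc[OF wf a, of u] by (auto simp: flat_sections_def arc_vec_def cone_rot_def)
    qed
    then show "q \<in> Z {?K u}"
      using q path_class_subset[OF wf, of u] by (auto simp: Z_def flat_sections_def)
  next
    fix q assume "q \<in> Z {?K u}"
    then show "q \<in> flat_sections k (?K u) \<gamma>"
      by (auto simp: Z_def flat_sections_def arc_vec_def)
  qed
  have fin: "finite (components H)"
    unfolding components_eq[OF wf] by simp
  have "int (dim (Z \<C>)) = (\<Sum>C\<in>\<C>. T_number k \<gamma> C)" if "\<C> \<subseteq> components H" for \<C>
    using finite_subset[OF that fin] that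
  proof (induction rule: finite_induct)
    case empty
    have "Z {} = {0}"
      using subspace_0[OF subZ[of "{}"]] by (auto simp: Z_def vec_eq_iff)
    then show ?case by simp
  next
    case (insert C \<C>)
    then obtain u where u: "u \<in> verts H" "C = ?K u"
      unfolding components_eq[OF wf] by blast
    have disj: "path_class H u \<inter> verts D = {}" if "D \<in> \<C>" for D
    proof -
      have "D \<in> components H" using insert.prems that by blast
      then obtain v where v: "D = ?K v" unfolding components_eq[OF wf] by blast
      then have "path_class H u \<noteq> path_class H v" using u insert that by auto
      then have "path_class H u \<inter> path_class H v = {}"
        using path_class_eq[OF wf] by blast
      then show ?thesis using v by simp
    qed
    have Zinter: "Z \<C> \<inter> Z {C} = {0}"
    proof -
      have "q = 0" if "q \<in> Z \<C>" "q \<in> Z {C}" for q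
        using that disj u by (auto simp: Z_def vec_eq_iff) blast
      then show ?thesis using subspace_0[OF subZ] by blast
    qed
    have Zsum: "{x + y |x y. x \<in> Z \<C> \<and> y \<in> Z {C}} = Z (insert C \<C>)"
    proof (intro equalityI subsetI)
      fix q assume "q \<in> {x + y |x y. x \<in> Z \<C> \<and> y \<in> Z {C}}"
      then obtain x y where q: "q = x + y" "x \<in> Z \<C>" "y \<in> Z {C}" by blast
      then have "x \<in> Z (insert C \<C>)" "y \<in> Z (insert C \<C>)" by (auto simp: Z_def)
      then show "q \<in> Z (insert C \<C>)"
        using q subspace_add[OF subZ] by simp
    next
      fix q assume q: "q \<in> Z (insert C \<C>)"
      define y where "y = (\<chi> i. if i \<in> path_class H u then q $ i else 0)"
      have "arc_vec k H \<gamma> a y = 0" if a: "a \<in> arcs H" for a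
      proof -
        have "arc_vec k H \<gamma> a q = 0" using q a by (simp add: Z_def flat_sections_def)
        then show ?thesis
          using path_class_arc[OF wf a, of u]
          by (cases "tail H a \<in> path_class H u") (auto simp: arc_vec_def y_def cone_rot_def)
      qed
      then have y: "y \<in> Z {C}"
        using path_class_subset[OF wf, of u] u by (auto simp: Z_def flat_sections_def y_def)
      then have "y \<in> flat_sections k H \<gamma>" "q \<in> flat_sections k H \<gamma>"
        using q by (auto simp: Z_def)
      then have "q - y \<in> flat_sections k H \<gamma>"
        by (rule subspace_diff[OF subspace_flat_sections, rotated])
      then have "q - y \<in> Z \<C>"
        using q u by (auto simp: Z_def y_def)
      moreover have "q = (q - y) + y" by simp
      ultimately show "q \<in> {x + y |x y. x \<in> Z \<C> \<and> y \<in> Z {C}}" using y by blast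
    qed
    have "dim (Z (insert C \<C>)) = dim (Z \<C>) + dim (Z {C})"
      using dim_sums_Int[OF subZ subZ, of \<C> "{C}"] by (simp add: Zinter Zsum)
    then show ?case
      using insert dimK[OF u(1)] flatK[OF u(1)] u by simp
  qed
  from this[of "components H"]
  have "int (dim (Z (components H))) = (\<Sum>C\<in>components H. T_number k \<gamma> C)" by simp
  moreover have "Z (components H) = flat_sections k H \<gamma>"
  proof -
    have "i \<in> (\<Union>C\<in>components H. verts C)" if "i \<in> verts H" for i
      using that unfolding components_eq[OF wf] path_class_def by (auto intro!: bexI[of _ i] exI[of _ "[]"])
    then show ?thesis by (auto simp: Z_def flat_sections_def)
  qed
  ultimately show ?thesis by simp
qed

section \<open>Local rigidity and the rank of the Jacobian\<close>

text \<open>The squared length of \<open>a\<close> is the squared norm of a linear map, and this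
  vector is half its gradient at \<open>p\<close>; dropping the factor 2 leaves spans
  unchanged.\<close>

definition arc_row :: "nat \<Rightarrow> ('w::finite, 'e) pre_digraph \<Rightarrow> ('e \<Rightarrow> int) \<Rightarrow> complex ^ 'w \<Rightarrow> 'e \<Rightarrow> complex ^ 'w"
  where "arc_row k G \<gamma> p a = adjoint (arc_vec k G \<gamma> a) (arc_vec k G \<gamma> a p)"

definition squared_lengths_deriv ::
    "nat \<Rightarrow> ('w::finite, 'e::finite) pre_digraph \<Rightarrow> ('e \<Rightarrow> int) \<Rightarrow> complex ^ 'w \<Rightarrow> complex ^ 'w \<Rightarrow> real ^ 'e"
  where "squared_lengths_deriv k G \<gamma> p h =
     (\<chi> a. if a \<in> arcs G then 2 * (arc_vec k G \<gamma> a p \<bullet> arc_vec k G \<gamma> a h) else 0)"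

definition turn :: "real \<Rightarrow> complex ^ 'w::finite \<Rightarrow> complex ^ 'w"
  where "turn t p = (\<chi> i. cis t * p $ i)"

text \<open>The velocity of \<open>turn t p\<close> at \<open>t = 0\<close>, that is, the trivial
  infinitesimal motion.\<close>

definition spin :: "complex ^ 'w::finite \<Rightarrow> complex ^ 'w"
  where "spin p = (\<chi> i. \<i> * p $ i)"

lemma inner_arc_row: "h \<bullet> arc_row k G \<gamma> p a = arc_vec k G \<gamma> a h \<bullet> arc_vec k G \<gamma> a p"
  by (simp add: arc_row_def adjoint_works[OF linear_arc_vec])

lemma linear_squared_lengths_deriv: "linear (squared_lengths_deriv k G \<gamma> p)"
  by (rule linearI)
    (simp_all add: squared_lengths_deriv_def vec_eq_iff linear_add[OF linear_arc_vec]
      linear_scale[OF linear_arc_vec] inner_add_right distrib_left)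

lemma linear_squared_lengths_deriv_left: "linear (\<lambda>p. squared_lengths_deriv k G \<gamma> p h)"
  by (rule linearI)
    (simp_all add: squared_lengths_deriv_def vec_eq_iff linear_add[OF linear_arc_vec]
      linear_scale[OF linear_arc_vec] inner_add_left distrib_left)

lemma squared_lengths_nth:
  "squared_lengths k G \<gamma> p $ a = (if a \<in> arcs G then arc_vec k G \<gamma> a p \<bullet> arc_vec k G \<gamma> a p else 0)"
  by (simp add: squared_lengths_def arc_vec_def power2_norm_eq_inner)

text \<open>Each coordinate is a quadratic form, so the expansion ends exactly with the second-order
  term; this takes the place of a Taylor estimate.\<close>

lemma squared_lengths_add:
  "squared_lengths k G \<gamma> (p + h) =
     squared_lengths k G \<gamma> p + squared_lengths_deriv k G \<gamma> p h + squared_lengths k G \<gamma> h"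
  by (simp add: vec_eq_iff squared_lengths_nth squared_lengths_deriv_def linear_add[OF linear_arc_vec]
      inner_add_left inner_add_right inner_commute)

lemma has_derivative_squared_lengths:
  fixes G :: "('w::finite, 'e::finite) pre_digraph"
  shows "(squared_lengths k G \<gamma> has_derivative squared_lengths_deriv k G \<gamma> p) (at p)"
proof (subst has_derivative_componentwise_within, intro ballI)
  fix b :: "real ^ 'e" assume "b \<in> Basis"
  then obtain a where b: "b = axis a 1" by (auto simp: Basis_vec_def)
  have nth: "x \<bullet> b = x $ a" for x
    by (simp add: b inner_axis)
  have bl: "bounded_linear (arc_vec k G \<gamma> a)"
    using linear_arc_vec by (simp add: linear_conv_bounded_linear)
  show "((\<lambda>x. squared_lengths k G \<gamma> x \<bullet> b) has_derivative (\<lambda>h. squared_lengths_deriv k G \<gamma> p h \<bullet> b)) (at p)"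
  proof (cases "a \<in> arcs G")
    case True
    have "((\<lambda>x. arc_vec k G \<gamma> a x \<bullet> arc_vec k G \<gamma> a x) has_derivative
       (\<lambda>h. arc_vec k G \<gamma> a p \<bullet> arc_vec k G \<gamma> a h + arc_vec k G \<gamma> a h \<bullet> arc_vec k G \<gamma> a p)) (at p)"
      by (intro has_derivative_inner bounded_linear.has_derivative[OF bl] has_derivative_ident)
    then show ?thesis
      unfolding nth using True by (simp add: squared_lengths_nth squared_lengths_deriv_def inner_commute)
  next
    case False
    then show ?thesis
      by (simp add: nth squared_lengths_nth squared_lengths_deriv_def)
  qed
qed

lemma kernel_squared_lengths_deriv:
  "{h. squared_lengths_deriv k G \<gamma> p h = 0} = {h. \<forall>x\<in>arc_row k G \<gamma> p ` arcs G. x \<bullet> h = 0}"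
proof -
  have "arc_row k G \<gamma> p a \<bullet> h = arc_vec k G \<gamma> a p \<bullet> arc_vec k G \<gamma> a h" for a h
    using inner_arc_row[of h k G \<gamma> p a] by (simp only: inner_commute)
  then show ?thesis
    by (auto simp: squared_lengths_deriv_def vec_eq_iff)
qed

lemma jacobian_rank_deriv: "jacobian_rank k G \<gamma> p = dim (range (squared_lengths_deriv k G \<gamma> p))"
  by (simp add: jacobian_rank_def frechet_derivative_at[OF has_derivative_squared_lengths, symmetric])

text \<open>Row rank equals column rank: both complement the dimension of the same kernel.\<close>

lemma jacobian_rank_eq: "jacobian_rank k G \<gamma> p = dim (arc_row k G \<gamma> p ` arcs G)"
  using dim_range_kernel[OF linear_squared_lengths_deriv, of k G \<gamma> p]
    dim_annihilator[of "arc_row k G \<gamma> p ` arcs G"]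
  by (simp add: jacobian_rank_deriv kernel_squared_lengths_deriv)

lemma jacobian_rank_kernel:
  fixes G :: "('w::finite, 'e::finite) pre_digraph"
  shows "jacobian_rank k G \<gamma> p + dim {h. squared_lengths_deriv k G \<gamma> p h = 0} = 2 * CARD('w)"
  using dim_range_kernel[OF linear_squared_lengths_deriv, of k G \<gamma> p]
  by (simp add: jacobian_rank_deriv)

lemma inner_ii: "(z::complex) \<bullet> (\<i> * z) = 0"
  by (simp add: inner_complex_def)

lemma arc_vec_spin: "arc_vec k G \<gamma> a (spin q) = \<i> * arc_vec k G \<gamma> a q"
  unfolding spin_def by (rule arc_vec_scale)

lemma arc_vec_turn: "arc_vec k G \<gamma> a (turn t q) = cis t * arc_vec k G \<gamma> a q"
  unfolding turn_def by (rule arc_vec_scale)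

lemma squared_lengths_deriv_spin: "squared_lengths_deriv k G \<gamma> p (spin p) = 0"
  by (simp add: squared_lengths_deriv_def vec_eq_iff arc_vec_spin inner_ii)

lemma squared_lengths_turn: "squared_lengths k G \<gamma> (turn t p) = squared_lengths k G \<gamma> p"
  by (simp add: vec_eq_iff squared_lengths_nth arc_vec_turn norm_mult flip: power2_norm_eq_inner)

lemma turn_turn: "turn s (turn t p) = turn (s + t) p"
  by (simp add: turn_def cis_mult[symmetric] mult.assoc)

lemma turn_0: "turn 0 p = p"
  by (simp add: turn_def vec_eq_iff)

lemma turn_eq: "turn t p = cos t *\<^sub>R p + sin t *\<^sub>R spin p"
  by (simp add: turn_def spin_def vec_eq_iff scaleR_conv_of_real[where 'a=complex]
      cis_conv_exp exp_Euler cos_of_real sin_of_real algebra_simps)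

lemma inner_spin: "p \<bullet> spin p = 0" "spin p \<bullet> spin p = p \<bullet> p"
  by (simp_all add: inner_vec_def spin_def inner_ii) (simp add: inner_complex_def add.commute)

lemma norm_turn: "norm (turn t p) = norm p"
  by (simp add: norm_vec_def turn_def norm_mult)

lemma linear_turn: "linear (turn t)"
  by (rule linearI) (simp_all add: turn_def vec_eq_iff algebra_simps)

section \<open>Rigidity modulo rotations at full and at deficient rank\<close>

definition locally_rigid ::
    "nat \<Rightarrow> ('w::finite, 'e::finite) pre_digraph \<Rightarrow> ('e \<Rightarrow> int) \<Rightarrow> complex ^ 'w \<Rightarrow> bool"
  where "locally_rigid k G \<gamma> p \<longleftrightarrow>
     (\<exists>e>0. \<forall>q. dist q p < e \<and> squared_lengths k G \<gamma> q = squared_lengths k G \<gamma> p \<longrightarrow> (\<exists>t. q = turn t p))"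

text \<open>The factor 4 is the square of the bound 2 for \<open>arc_vec\<close> from the triangle
  inequality; \<open>CARD('e)\<close> comes from estimating the Euclidean norm by the sum of the
  coordinates.\<close>

lemma squared_lengths_bound:
  fixes G :: "('w::finite, 'e::finite) pre_digraph"
  shows "norm (squared_lengths k G \<gamma> h) \<le> real CARD('e) * 4 * (norm h)\<^sup>2"
proof -
  have "\<bar>squared_lengths k G \<gamma> h $ a\<bar> \<le> 4 * (norm h)\<^sup>2" for a
  proof (cases "a \<in> arcs G")
    case True
    have "norm (arc_vec k G \<gamma> a h) \<le> norm (cone_rot k (\<gamma> a) (h $ head G a)) + norm (h $ tail G a)"
      unfolding arc_vec_def by (rule norm_triangle_ineq4)
    also have "\<dots> \<le> norm h + norm h"
      by (intro add_mono) (simp_all add: cone_rot_def norm_mult Finite_Cartesian_Product.norm_nth_le)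
    finally have "(norm (arc_vec k G \<gamma> a h))\<^sup>2 \<le> (2 * norm h)\<^sup>2"
      by (intro power_mono) auto
    then show ?thesis
      using True by (simp add: squared_lengths_nth power2_norm_eq_inner power_mult_distrib)
  next
    case False
    then show ?thesis by (simp add: squared_lengths_nth)
  qed
  then have "(\<Sum>a\<in>UNIV. \<bar>squared_lengths k G \<gamma> h $ a\<bar>) \<le> (\<Sum>a\<in>(UNIV::'e set). 4 * (norm h)\<^sup>2)"
    by (intro sum_mono)
  then show ?thesis
    using norm_le_l1_cart[of "squared_lengths k G \<gamma> h"] by simp
qed

text \<open>Rotating \<open>r\<close> by minus the argument of the Hermitian product
  \<open>H\<close> makes this product real and non-negative. Its imaginary part is the inner product
  with \<open>spin p\<close>, its real part the one with \<open>p\<close>; so the rotated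
  \<open>r\<close> is orthogonal to \<open>spin p\<close> and as close to \<open>p\<close> as a
  rotation can bring it.\<close>

lemma closest_rotation:
  fixes p r :: "complex ^ 'w::finite"
  obtains t where "turn t r \<bullet> spin p = 0" "norm (turn t r - p) \<le> norm (r - p)"
proof -
  define H where "H = (\<Sum>i\<in>UNIV. cnj (p $ i) * r $ i)"
  define t where "t = - Arg H"
  have H: "cis t * H = of_real (norm H)"
  proof -
    have "H = rcis (norm H) (Arg H)" by (simp add: rcis_cmod_Arg)
    then have "cis t * H = of_real (norm H) * (cis (Arg H) * cis t)"
      by (metis mult.commute mult.left_commute rcis_def)
    then show ?thesis by (simp add: t_def cis_mult)
  qed
  have inner_Re: "turn s r \<bullet> p = Re (cis s * H)" for s
    by (simp add: H_def inner_vec_def turn_def inner_complex_def sum_distrib_left algebra_simps)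
  have "turn t r \<bullet> spin p = Im (cis t * H)"
    by (simp add: H_def inner_vec_def turn_def spin_def inner_complex_def sum_distrib_left algebra_simps)
  then have "turn t r \<bullet> spin p = 0" by (simp add: H)
  moreover have "norm (turn t r - p) \<le> norm (r - p)"
  proof -
    have "turn t r \<bullet> p = norm H" by (simp add: inner_Re H)
    moreover have "r \<bullet> p \<le> norm H"
      using inner_Re[of 0] complex_Re_le_cmod[of H] by (simp add: turn_0)
    ultimately have "r \<bullet> p \<le> turn t r \<bullet> p" by simp
    then have "(norm (turn t r - p))\<^sup>2 \<le> (norm (r - p))\<^sup>2"
      by (simp add: dot_norm_neg norm_turn)
    then show ?thesis by (simp add: power2_le_iff_abs_le)
  qed
  ultimately show ?thesis using that by blast
qed

lemma locally_rigid_if_rank: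
  fixes G :: "('w::finite, 'e::finite) pre_digraph"
  assumes rank: "jacobian_rank k G \<gamma> p + 1 = 2 * CARD('w)"
  shows "locally_rigid k G \<gamma> p"
proof -
  let ?D = "squared_lengths_deriv k G \<gamma> p"
  define K where "K = {h. ?D h = 0}"
  have subK: "subspace K"
    unfolding K_def by (rule linear_subspace_kernel[OF linear_squared_lengths_deriv])
  have dimK: "dim K = 1"
    using jacobian_rank_kernel[of k G \<gamma> p] rank by (simp add: K_def)
  have "p \<noteq> 0"
  proof
    assume "p = 0"
    then have "K = UNIV"
      unfolding K_def using linear_0[OF linear_squared_lengths_deriv_left] by auto
    then show False using dimK by simp
  qed
  then have spin: "spin p \<noteq> 0" "spin p \<bullet> spin p > 0"
    using inner_spin(2)[of p] by (metis inner_eq_zero_iff, simp)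
  have "span {spin p} = K"
  proof (rule subspace_dim_equal)
    show "span {spin p} \<subseteq> K"
      using subK squared_lengths_deriv_spin[of k G \<gamma> p] by (intro span_minimal) (auto simp: K_def)
    show "dim K \<le> dim (span {spin p})"
      using dimK spin by (simp add: dim_singleton)
  qed (use subK in auto)
  define C where "C = {h. spin p \<bullet> h = 0}"
  have subC: "subspace C"
    unfolding C_def by (rule subspace_hyperplane)
  have inj: "h = 0" if h: "h \<in> C" "?D h = 0" for h
  proof -
    have "h \<in> span {spin p}" using h \<open>span {spin p} = K\<close> by (simp add: K_def)
    then obtain c where "h = c *\<^sub>R spin p" by (auto simp: span_singleton)
    then show ?thesis using h spin by (simp add: C_def)
  qed
  have "bounded_linear ?D"
    using linear_squared_lengths_deriv by (simp add: linear_conv_bounded_linear)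
  then obtain e where e: "e > 0" "\<And>h. h \<in> C \<Longrightarrow> e * norm h \<le> norm (?D h)"
    using injective_imp_isometric[OF closed_subspace[OF subC] subC, of ?D] inj by blast
  define M where "M = real CARD('e) * 4"
  have M: "M > 0" by (simp add: M_def)
  \<comment> \<open>Within radius \<open>e / M\<close> a non-zero \<open>h\<close> orthogonal to
    \<open>spin p\<close> satisfies \<open>M * norm h < e\<close>, so the second-order term is too
    small to cancel the linear one.\<close>
  have "\<exists>t. q = turn t p"
    if q: "dist q p < e / M" "squared_lengths k G \<gamma> q = squared_lengths k G \<gamma> p" for q
  proof -
    obtain t where t: "turn t q \<bullet> spin p = 0" "norm (turn t q - p) \<le> norm (q - p)"
      by (rule closest_rotation)
    define h where "h = turn t q - p"
    have hC: "h \<in> C"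
      using t(1) inner_spin(1)[of p] by (simp add: h_def C_def inner_commute inner_diff_right)
    have "squared_lengths k G \<gamma> p = squared_lengths k G \<gamma> (p + h)"
      using q squared_lengths_turn[of k G \<gamma> t q] by (simp add: h_def)
    then have "?D h = - squared_lengths k G \<gamma> h"
      by (simp add: squared_lengths_add eq_neg_iff_add_eq_0)
    then have "e * norm h \<le> M * (norm h)\<^sup>2"
      using e(2)[OF hC] squared_lengths_bound[of k G \<gamma> h] by (simp add: M_def)
    moreover have "M * (norm h)\<^sup>2 < e * norm h" if "h \<noteq> 0"
    proof -
      have "M * norm h < e"
        using t(2) q(1) M by (simp add: h_def dist_norm field_simps) (smt (verit) mult_less_cancel_left)
      then have "M * norm h * norm h < e * norm h"
        using that by (intro mult_strict_right_mono) auto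
      then show ?thesis by (simp add: power2_eq_square)
    qed
    ultimately have "h = 0" by force
    then have "turn (- t) (turn t q) = turn (- t) p" by (simp add: h_def)
    then show ?thesis by (auto simp: turn_turn turn_0)
  qed
  then show ?thesis
    unfolding locally_rigid_def using e M by (intro exI[of _ "e / M"]) auto
qed

text \<open>A kernel of dimension at least 2 contains a \<open>\<kappa>\<close> orthogonal to
  \<open>spin p\<close>; the nearby \<open>q\<close> of equal lengths then has \<open>q - p\<close>
  orthogonal to \<open>spin p\<close>. Were \<open>q\<close> a rotated copy of \<open>p\<close>,
  only \<open>q = p\<close> and the half turn would remain.\<close>

lemma not_locally_rigid_if_rank:
  fixes G :: "('w::finite, 'e::finite) pre_digraph"
  assumes rank: "jacobian_rank k G \<gamma> p + 2 \<le> 2 * CARD('w)"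
    and U: "open U" "p \<in> U"
    and max: "\<And>q. q \<in> U \<Longrightarrow> jacobian_rank k G \<gamma> q \<le> jacobian_rank k G \<gamma> p"
  shows "\<not> locally_rigid k G \<gamma> p"
proof
  let ?D = "squared_lengths_deriv k G \<gamma>"
  assume "locally_rigid k G \<gamma> p"
  then obtain e where e: "e > 0"
    "\<And>q. dist q p < e \<Longrightarrow> squared_lengths k G \<gamma> q = squared_lengths k G \<gamma> p \<Longrightarrow> \<exists>t. q = turn t p"
    unfolding locally_rigid_def by blast
  define J where "J q = Blinfun (?D q)" for q
  have J: "blinfun_apply (J q) = ?D q" for q
    unfolding J_def using linear_squared_lengths_deriv
    by (intro bounded_linear_Blinfun_apply) (simp add: linear_conv_bounded_linear)
  have "linear J"
    by (rule linearI; rule blinfun_eqI)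
      (simp_all add: J blinfun.add_left blinfun.scaleR_left linear_add[OF linear_squared_lengths_deriv_left]
        linear_scale[OF linear_squared_lengths_deriv_left])
  then have cont: "continuous_on U J"
    by (simp add: linear_continuous_on linear_conv_bounded_linear)
  define K where "K = {h. ?D p h = 0}"
  have subK: "subspace K"
    unfolding K_def by (rule linear_subspace_kernel[OF linear_squared_lengths_deriv])
  have spinK: "spin p \<in> K" by (simp add: K_def squared_lengths_deriv_spin)
  have "dim {y \<in> K. \<forall>x\<in>span {spin p}. orthogonal x y} + dim (span {spin p}) = dim K"
    using spinK subK by (intro dim_subspace_orthogonal_to_vectors span_minimal) auto
  moreover have "dim K \<ge> 2"
    using jacobian_rank_kernel[of k G \<gamma> p] rank by (simp add: K_def)
  moreover have "dim (span {spin p}) \<le> 1" by (simp add: dim_singleton)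
  ultimately have "dim {y \<in> K. \<forall>x\<in>span {spin p}. orthogonal x y} \<noteq> 0" by linarith
  then have "\<not> {y \<in> K. \<forall>x\<in>span {spin p}. orthogonal x y} \<subseteq> {0}"
    by (simp add: dim_eq_0)
  then obtain \<kappa> where kappa: "\<kappa> \<in> K" "\<kappa> \<noteq> 0" "\<forall>x\<in>span {spin p}. orthogonal x \<kappa>"
    by blast
  then have kappa_spin: "spin p \<bullet> \<kappa> = 0"
    by (simp add: orthogonal_def span_base)
  \<comment> \<open>The half turn moves \<open>p\<close> by \<open>2 * norm p\<close>, so the bound
    \<open>norm p\<close> excludes it; for \<open>p = 0\<close> every rotation fixes
    \<open>p\<close>.\<close>
  have ee: "(if p = 0 then e else min e (norm p)) > 0" using e by auto
  obtain q t where q: "dist q p < (if p = 0 then e else min e (norm p))"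
      "squared_lengths k G \<gamma> q = squared_lengths k G \<gamma> p" "t \<noteq> 0"
      "\<And>y. ?D p y = 0 \<Longrightarrow> (q - p) \<bullet> y = t * (\<kappa> \<bullet> y)"
  proof (rule constant_rank_fibre[OF U _ cont _ _ ee, of "squared_lengths k G \<gamma>" \<kappa>])
    show "(squared_lengths k G \<gamma> has_derivative blinfun_apply (J x)) (at x)" for x
      unfolding J by (rule has_derivative_squared_lengths)
    show "dim (range (blinfun_apply (J x))) \<le> dim (range (blinfun_apply (J p)))" if "x \<in> U" for x
      using max[OF that] by (simp add: J jacobian_rank_deriv)
    show "blinfun_apply (J p) \<kappa> = 0" using kappa by (simp add: J K_def)
  qed (use J in auto)
  have "dist q p < e" using q(1) by (auto split: if_splits)
  then obtain s where s: "q = turn s p" using e(2) q(2) by blast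
  have "(q - p) \<bullet> spin p = 0"
    using q(4)[of "spin p"] spinK kappa_spin by (simp add: K_def inner_commute)
  then have "sin s * (p \<bullet> p) = 0"
    using inner_spin[of p] by (simp add: s turn_eq inner_diff_left inner_add_left)
  moreover have "q = p" if "p \<noteq> 0" "sin s = 0"
  proof -
    have "cos s = 1 \<or> cos s = - 1"
      using sin_cos_squared_add[of s] that(2) by (simp add: power2_eq_1_iff)
    moreover have "cos s \<noteq> - 1"
    proof
      assume "cos s = - 1"
      then have "q - p = - (2 *\<^sub>R p)"
        using that(2) by (simp add: s turn_eq scaleR_2)
      then have "norm (q - p) = 2 * norm p" by simp
      then show False using q(1) that(1) by (simp add: dist_norm)
    qed
    ultimately show ?thesis using that(2) by (simp add: s turn_eq)
  qed
  moreover have "q = p" if "p = 0"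
    using that s by (simp add: turn_def vec_eq_iff)
  ultimately have "q = p" by auto
  then have "t * (\<kappa> \<bullet> \<kappa>) = 0" using q(4)[of \<kappa>] kappa by (simp add: K_def)
  then show False using q(3) kappa by simp
qed

section \<open>The cone-Laman count and independence\<close>

text \<open>Places the rows of a subgraph in the coordinates of its own vertices, so that the
  ambient dimension in the count is twice the number of these vertices.\<close>

lemma arc_row_support:
  assumes "i \<noteq> head G a" "i \<noteq> tail G a"
  shows "arc_row k G \<gamma> p a $ i = 0"
proof -
  have "arc_row k G \<gamma> p a $ i \<bullet> z = 0" for z
  proof -
    have "arc_row k G \<gamma> p a $ i \<bullet> z = axis i z \<bullet> arc_row k G \<gamma> p a"
      by (simp add: inner_axis' inner_commute)
    also have "\<dots> = 0"
      using assms by (simp add: inner_arc_row arc_vec_def axis_def cone_rot_def)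
    finally show ?thesis .
  qed
  then show ?thesis by (metis inner_eq_zero_iff)
qed

lemma dim_supported:
  fixes V :: "'w::finite set"
  shows "dim {q :: complex ^ 'w. \<forall>i. i \<notin> V \<longrightarrow> q $ i = 0} \<le> 2 * card V"
proof -
  let ?B = "(\<lambda>i. axis i 1) ` V \<union> (\<lambda>i. axis i \<i>) ` V :: (complex ^ 'w) set"
  have "q \<in> span ?B" if "\<forall>i. i \<notin> V \<longrightarrow> q $ i = 0" for q :: "complex ^ 'w"
  proof -
    have "q = (\<Sum>i\<in>V. Re (q $ i) *\<^sub>R axis i 1 + Im (q $ i) *\<^sub>R axis i \<i>)"
    proof -
      have "(\<Sum>i\<in>V. Re (q $ i) *\<^sub>R axis i 1 + Im (q $ i) *\<^sub>R axis i \<i>) $ j =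
          (\<Sum>i\<in>V. if i = j then q $ i else 0)" for j
        unfolding sum_component by (intro sum.cong) (auto simp: axis_def complex_eq_iff)
      then show ?thesis using that by (simp add: vec_eq_iff)
    qed
    also have "\<dots> \<in> span ?B"
      by (intro span_sum span_add span_scale span_base) auto
    finally show ?thesis .
  qed
  then have "dim {q :: complex ^ 'w. \<forall>i. i \<notin> V \<longrightarrow> q $ i = 0} \<le> card ?B"
    by (intro dim_le_card) auto
  also have "\<dots> \<le> card ((\<lambda>i. axis i 1 :: complex ^ 'w) ` V) + card ((\<lambda>i. axis i \<i> :: complex ^ 'w) ` V)"
    by (rule card_Un_le)
  also have "\<dots> \<le> 2 * card V"
    unfolding mult_2 by (intro add_mono card_image_le) auto
  finally show ?thesis .
qed

lemma colored_graph_subgraph: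
  assumes "colored_graph k G \<gamma>" "subgraph H G"
  shows "colored_graph k H \<gamma>"
proof -
  have "finite (verts H)" "finite (arcs H)" "wf_digraph H"
    using assms by (auto simp: colored_graph_def fin_digraph_def fin_digraph_axioms_def subgraph_def
        intro: finite_subset)
  then show ?thesis
    using assms by (auto simp: colored_graph_def fin_digraph_def fin_digraph_axioms_def subgraph_def)
qed

text \<open>
  Infinitesimal motions of \<open>H\<close> are the translations of the components with trivial \<open>\<rho>\<close>-image,
  that is, the flat sections, and the rotation about the origin.
\<close>

lemma subgraph_count_if_independent:
  fixes G :: "('w::finite, 'e::finite) pre_digraph"
  assumes k: "k > 0" and col: "colored_graph k G \<gamma>"
    and nz: "\<And>a. a \<in> arcs G \<Longrightarrow> arc_vec k G \<gamma> a p \<noteq> 0"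
    and indep: "dim (arc_row k G \<gamma> p ` arcs G) = card (arcs G)"
    and H: "subgraph H G" "arcs H \<noteq> {}"
  shows "int (card (arcs H)) \<le> 2 * int (card (verts H)) - 1 - (\<Sum>C\<in>components H. T_number k \<gamma> C)"
proof -
  let ?\<rho> = "arc_row k G \<gamma> p" and ?Z = "flat_sections k H \<gamma>"
  have wfH: "wf_digraph H" and HG: "arcs H \<subseteq> arcs G" "tail H = tail G" "head H = head G"
    using H by (auto simp: subgraph_def compatible_def)
  define S where "S = {q :: complex ^ 'w. \<forall>i. i \<notin> verts H \<longrightarrow> q $ i = 0}"
  have subS: "subspace S" by (auto simp: S_def subspace_def)
  \<comment> \<open>The rotation is cut off to the vertices of \<open>H\<close>; arcs of
    \<open>H\<close> do not see the cut, as both their ends lie in \<open>H\<close>.\<close>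
  define x where "x = (\<chi> i. if i \<in> verts H then spin p $ i else 0)"
  have arc_x: "arc_vec k G \<gamma> a x = \<i> * arc_vec k G \<gamma> a p" if "a \<in> arcs H" for a
  proof -
    have "head G a \<in> verts H" "tail G a \<in> verts H"
      using wfH that HG by (auto simp: wf_digraph_def)
    then have "arc_vec k G \<gamma> a x = arc_vec k G \<gamma> a (spin p)"
      by (simp add: arc_vec_def x_def)
    then show ?thesis by (simp add: arc_vec_spin)
  qed
  \<comment> \<open>\<open>H\<close> has an arc and it is not collapsed, so the rotation is not flat
    on it. This extra dimension is the \<open>- 1\<close> of the count.\<close>
  have xZ: "x \<notin> span ?Z"
  proof
    assume "x \<in> span ?Z"
    then have "x \<in> ?Z" using subspace_flat_sections by (metis span_eq_iff)
    then show False
      using H(2) HG arc_x nz by (force simp: flat_sections_def arc_vec_subgraph[OF H(1)])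
  qed
  have "dim (?\<rho> ` arcs H) = card (arcs H)"
    using indep HG by (intro dim_subset_full_rank[of "arcs G" ?\<rho> "arcs H"]) auto
  moreover have "dim {y \<in> S. \<forall>x\<in>span (?\<rho> ` arcs H). orthogonal x y} + dim (span (?\<rho> ` arcs H)) = dim S"
  proof (rule dim_subspace_orthogonal_to_vectors)
    have "?\<rho> a \<in> S" if "a \<in> arcs H" for a
    proof -
      have "head G a \<in> verts H" "tail G a \<in> verts H"
        using wfH that HG by (auto simp: wf_digraph_def)
      then show ?thesis
        unfolding S_def by (auto intro!: arc_row_support)
    qed
    then show "span (?\<rho> ` arcs H) \<subseteq> S"
      by (intro span_minimal subS) auto
  qed (use subS in auto)
  moreover have "dim (insert x ?Z) \<le> dim {y \<in> S. \<forall>x\<in>span (?\<rho> ` arcs H). orthogonal x y}"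
  proof (rule dim_subset, rule subsetI, intro CollectI conjI ballI)
    fix y v assume y: "y \<in> insert x ?Z"
    then show "y \<in> S" by (auto simp: S_def x_def flat_sections_def)
    have "orthogonal y (?\<rho> a)" if "a \<in> arcs H" for a
      using y arc_x[OF that] that inner_ii[of "arc_vec k G \<gamma> a p"]
      by (auto simp: orthogonal_def inner_arc_row flat_sections_def arc_vec_subgraph[OF H(1)] inner_commute)
    moreover assume "v \<in> span (?\<rho> ` arcs H)"
    ultimately show "orthogonal v y"
      using orthogonal_to_span[of v "?\<rho> ` arcs H" y] orthogonal_commute by blast
  qed
  moreover have "dim (insert x ?Z) = dim ?Z + 1"
    using xZ by (simp add: dim_insert)
  moreover have "dim S \<le> 2 * card (verts H)"
    unfolding S_def by (rule dim_supported)
  ultimately have "int (card (arcs H)) + int (dim ?Z) + 1 \<le> 2 * int (card (verts H))"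
    by simp
  then show ?thesis
    using dim_flat_sections[OF k colored_graph_subgraph[OF col H(1)]] by simp
qed

text \<open>The ranges are jointly annihilated exactly by the flat sections of the subgraph with
  arcs \<open>F\<close>, so their span has dimension \<open>2 * CARD('w)\<close> minus the sum of
  the T-numbers. The cone-Laman count leaves a surplus of 1 over \<open>card F\<close>, which pays
  for doubling one arc.\<close>

lemma arc_ranges_count_if_cone_laman:
  fixes G :: "('w::finite, 'e::finite) pre_digraph"
  assumes k: "k > 0" and col: "colored_graph k G \<gamma>" and V: "verts G = UNIV"
    and laman: "cone_laman k G \<gamma>" and F: "F \<subseteq> arcs G" "F \<noteq> {}"
  shows "card F + 1 \<le> dim (\<Union>a\<in>F. range (adjoint (arc_vec k G \<gamma> a)))"
proof -
  \<comment> \<open>All vertices are kept: an isolated one adds 2 to twice the number of vertices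
    and, as a component without non-trivial closed paths, 2 to the sum of the T-numbers, so the two
    cancel.\<close>
  define H where "H = G\<lparr>arcs := F\<rparr>"
  have wf: "wf_digraph G" using col by (simp add: colored_graph_def fin_digraph_def)
  have H: "subgraph H G"
    using wf F V by (auto simp: subgraph_def H_def compatible_def wf_digraph_def)
  have finF: "finite F" by simp
  have "{y. \<forall>x\<in>(\<Union>a\<in>F. range (adjoint (arc_vec k G \<gamma> a))). x \<bullet> y = 0} = flat_sections k H \<gamma>"
  proof -
    have "(\<forall>z. adjoint (arc_vec k G \<gamma> a) z \<bullet> y = 0) \<longleftrightarrow> arc_vec k G \<gamma> a y = 0" for a y
    proof -
      have "adjoint (arc_vec k G \<gamma> a) z \<bullet> y = arc_vec k G \<gamma> a y \<bullet> z" for z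
        using adjoint_works[OF linear_arc_vec] by (metis inner_commute)
      then show ?thesis by (metis inner_eq_zero_iff inner_zero_left)
    qed
    then show ?thesis
      using V by (auto simp: flat_sections_def arc_vec_subgraph[OF H]) (auto simp: H_def)
  qed
  then have "dim (\<Union>a\<in>F. range (adjoint (arc_vec k G \<gamma> a))) + dim (flat_sections k H \<gamma>) = 2 * CARD('w)"
    using dim_annihilator[of "\<Union>a\<in>F. range (adjoint (arc_vec k G \<gamma> a))"] by simp
  moreover have "int (card F) \<le> 2 * int CARD('w) - 1 - int (dim (flat_sections k H \<gamma>))"
  proof -
    have "card (arcs H) \<ge> 1" using F finF by (simp add: H_def Suc_le_eq card_gt_0_iff)
    then have "int (card (arcs H)) \<le> 2 * int (card (verts H)) - 1 - (\<Sum>C\<in>components H. T_number k \<gamma> C)"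
      using laman H unfolding cone_laman_def by blast
    then show ?thesis
      using dim_flat_sections[OF k colored_graph_subgraph[OF col H]] V by (simp add: H_def)
  qed
  ultimately show ?thesis by linarith
qed

text \<open>Directions are specialised one index at a time along the line
  \<open>1 + x * \<i>\<close>, while Rado's condition is kept for all doubled indices
  \<open>c\<close> simultaneously; weight 2 on \<open>c\<close> encodes the doubling.\<close>

lemma generic_directions:
  fixes L :: "'i \<Rightarrow> complex \<Rightarrow> 'a::euclidean_space"
  assumes fin: "finite A" and lin: "\<And>a. linear (L a)"
    and rank: "\<And>F. F \<subseteq> A \<Longrightarrow> F \<noteq> {} \<Longrightarrow> card F + 1 \<le> dim (\<Union>a\<in>F. range (L a))"
  obtains s where "\<And>a. s a \<noteq> 0"
    "\<And>c. c \<in> A \<Longrightarrow> card A + 1 \<le> dim (range (L c) \<union> (\<lambda>a. L a (s a)) ` A)"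
proof -
  define w where "w c b = (if b = c then 2 else 1::nat)" for c b :: 'i
  \<comment> \<open>Indices in \<open>S\<close> have received their direction, the others still
    carry their full range. The doubled index \<open>c\<close> keeps its range to the end, whence
    \<open>range (L c)\<close> in the conclusion.\<close>
  define Y where "Y S s c b = (if b \<in> S \<and> b \<noteq> c then {L b (s b)} else range (L b))" for S s and c b :: 'i
  have L_Complex: "L a z = Re z *\<^sub>R L a 1 + Im z *\<^sub>R L a \<i>" for a z
  proof -
    have "z = Re z *\<^sub>R 1 + Im z *\<^sub>R \<i>" by (simp add: complex_eq_iff)
    then have "L a z = L a (Re z *\<^sub>R 1 + Im z *\<^sub>R \<i>)" by simp
    then show ?thesis using linear_add[OF lin] linear_scale[OF lin] by metis
  qed
  have sum_w: "sum (w c) F = card F + (if c \<in> F then 1 else 0)" if "F \<subseteq> A" for c F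
  proof -
    have finF: "finite F" using that fin finite_subset by blast
    have "sum (w c) F = (\<Sum>b\<in>F. 1 + (if b = c then 1 else 0))"
      by (intro sum.cong) (auto simp: w_def)
    also have "\<dots> = card F + (if c \<in> F then 1 else 0)"
      unfolding sum.distrib using finF by simp
    finally show ?thesis .
  qed
  have "\<exists>s. (\<forall>a. s a \<noteq> 0) \<and> (\<forall>c\<in>A. \<forall>F\<subseteq>A. sum (w c) F \<le> dim (\<Union>b\<in>F. Y S s c b))" if "S \<subseteq> A" for S
    using finite_subset[OF that fin] that
  proof (induction rule: finite_induct)
    case empty
    have "sum (w c) F \<le> dim (\<Union>b\<in>F. range (L b))" if "F \<subseteq> A" for c F
      using rank[OF that] sum_w[OF that, of c] by (cases "F = {}") auto
    then show ?case
      by (intro exI[of _ "\<lambda>_. 1"]) (simp add: Y_def)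
  next
    case (insert a S)
    then obtain s where "(\<forall>a. s a \<noteq> 0) \<and> (\<forall>c\<in>A. \<forall>F\<subseteq>A. sum (w c) F \<le> dim (\<Union>b\<in>F. Y S s c b))"
      by blast
    then have s: "\<And>a. s a \<noteq> 0"
      "\<And>c F. c \<in> A \<Longrightarrow> F \<subseteq> A \<Longrightarrow> sum (w c) F \<le> dim (\<Union>b\<in>F. Y S s c b)"
      by simp_all
    have aA: "a \<in> A" using insert by simp
    define good where "good c x \<longleftrightarrow>
      (\<forall>F\<subseteq>A - {a}. sum (w c) F < dim (insert (L a 1 + x *\<^sub>R L a \<i>) (\<Union>b\<in>F. Y S s c b)))"
      for c and x :: real
    \<comment> \<open>Two different parameters on the line span all of \<open>range (L a)\<close>,
      so at most one parameter is bad for each \<open>c\<close>.\<close>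
    have one: "good c x \<or> good c y" if "c \<in> A" "c \<noteq> a" "x \<noteq> y" for c x y
      unfolding good_def
    proof (rule rado_step[OF fin aA])
      show "w c a = 1" using that by (simp add: w_def)
      show "sum (w c) F \<le> dim (\<Union>b\<in>F. Y S s c b)" if "F \<subseteq> A" for F
        using s(2)[OF \<open>c \<in> A\<close> that] .
      let ?W = "span {L a 1 + x *\<^sub>R L a \<i>, L a 1 + y *\<^sub>R L a \<i>}"
      have W: "L a 1 + x *\<^sub>R L a \<i> \<in> ?W" "L a 1 + y *\<^sub>R L a \<i> \<in> ?W"
        by (auto intro: span_base)
      have "(1 / (x - y)) *\<^sub>R ((L a 1 + x *\<^sub>R L a \<i>) - (L a 1 + y *\<^sub>R L a \<i>)) \<in> ?W"
        using W by (intro span_scale span_diff)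
      also have "(1 / (x - y)) *\<^sub>R ((L a 1 + x *\<^sub>R L a \<i>) - (L a 1 + y *\<^sub>R L a \<i>)) = L a \<i>"
        using \<open>x \<noteq> y\<close> by (simp flip: scaleR_left_diff_distrib)
      finally have i: "L a \<i> \<in> ?W" .
      have "(L a 1 + x *\<^sub>R L a \<i>) - x *\<^sub>R L a \<i> \<in> ?W"
        using W i by (intro span_scale span_diff)
      then have "L a 1 \<in> ?W" by simp
      then have "L a z \<in> ?W" for z
        using i by (subst L_Complex) (intro span_add span_scale)
      then show "Y S s c a \<subseteq> ?W"
        using insert by (auto simp: Y_def)
    qed
    \<comment> \<open>Each \<open>c\<close> excludes at most one real parameter, so a common good
      one remains. The case \<open>c = a\<close> is left out because the doubled index is not
      specialised.\<close>
    have "finite (\<Union>c\<in>A - {a}. {x. \<not> good c x})"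
    proof (intro finite_UN_I)
      fix c assume "c \<in> A - {a}"
      then have "x = y" if "\<not> good c x" "\<not> good c y" for x y
        using one that by blast
      then have "{x. \<not> good c x} \<subseteq> {y}" if "\<not> good c y" for y
        using that by blast
      then show "finite {x. \<not> good c x}"
        by (cases "\<exists>y. \<not> good c y") (auto intro: finite_subset)
    qed (use fin in auto)
    then obtain x where x: "x \<notin> (\<Union>c\<in>A - {a}. {x. \<not> good c x})"
      using ex_new_if_finite[OF infinite_UNIV_char_0] by blast
    define s' where "s' = s(a := Complex 1 x)"
    have "sum (w c) F \<le> dim (\<Union>b\<in>F. Y (insert a S) s' c b)" if c: "c \<in> A" and F: "F \<subseteq> A" for c F
    proof (cases "c = a \<or> a \<notin> F")
      case True
      then have "(\<Union>b\<in>F. Y (insert a S) s' c b) = (\<Union>b\<in>F. Y S s c b)"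
        using insert(2) by (intro SUP_cong) (auto simp: Y_def s'_def)
      then show ?thesis using s(2)[OF c F] by simp
    next
      case False
      have "(\<Union>b\<in>F. Y (insert a S) s' c b) = insert (L a (Complex 1 x)) (\<Union>b\<in>F - {a}. Y (insert a S) s' c b)"
        using False by (auto simp: Y_def s'_def)
      also have "(\<Union>b\<in>F - {a}. Y (insert a S) s' c b) = (\<Union>b\<in>F - {a}. Y S s c b)"
        by (intro SUP_cong) (auto simp: Y_def s'_def)
      finally have Y_F: "(\<Union>b\<in>F. Y (insert a S) s' c b) = insert (L a 1 + x *\<^sub>R L a \<i>) (\<Union>b\<in>F - {a}. Y S s c b)"
        by (simp add: L_Complex[of a "Complex 1 x"])
      have w_F: "sum (w c) F = 1 + sum (w c) (F - {a})"
        using False F fin by (subst sum.remove[of F a]) (auto simp: w_def intro: finite_subset)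
      have "sum (w c) (F - {a}) < dim (insert (L a 1 + x *\<^sub>R L a \<i>) (\<Union>b\<in>F - {a}. Y S s c b))"
      proof -
        have "good c x" using x c False by blast
        moreover have "F - {a} \<subseteq> A - {a}" using F by blast
        ultimately show ?thesis unfolding good_def by blast
      qed
      then show ?thesis
        unfolding Y_F w_F by simp
    qed
    moreover have "s' b \<noteq> 0" for b
      using s(1) by (simp add: s'_def complex_eq_iff)
    ultimately show ?case by blast
  qed
  from this[OF order_refl] obtain s
    where "(\<forall>a. s a \<noteq> 0) \<and> (\<forall>c\<in>A. \<forall>F\<subseteq>A. sum (w c) F \<le> dim (\<Union>b\<in>F. Y A s c b))"
    by blast
  then have s: "\<And>a. s a \<noteq> 0"
    "\<And>c F. c \<in> A \<Longrightarrow> F \<subseteq> A \<Longrightarrow> sum (w c) F \<le> dim (\<Union>b\<in>F. Y A s c b)"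
    by simp_all
  have "card A + 1 \<le> dim (range (L c) \<union> (\<lambda>a. L a (s a)) ` A)" if c: "c \<in> A" for c
  proof -
    have "card A + 1 \<le> dim (\<Union>b\<in>A. Y A s c b)"
      using s(2)[OF c, of A] sum_w[of A c] c by simp
    also have "\<dots> \<le> dim (range (L c) \<union> (\<lambda>a. L a (s a)) ` A)"
      by (intro dim_subset) (auto simp: Y_def split: if_splits)
    finally show ?thesis .
  qed
  then show ?thesis using that s(1) by blast
qed

section \<open>From generic directions to a realization of full rank\<close>

lemma linear_spin: "linear spin"
  by (rule linearI) (simp_all add: spin_def vec_eq_iff algebra_simps)

lemma spin_spin: "spin (spin q) = - q"
  by (simp add: spin_def vec_eq_iff)

lemma orthogonal_complex:
  assumes "(z::complex) \<bullet> s = 0" "s \<noteq> 0"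
  obtains r where "z = r *\<^sub>R (\<i> * s)"
proof -
  have n: "(Re s)\<^sup>2 + (Im s)\<^sup>2 \<noteq> 0"
    using assms(2) by (simp add: complex_eq_iff sum_power2_eq_zero_iff)
  have o: "Re z * Re s + Im z * Im s = 0" using assms(1) by (simp add: inner_complex_def)
  \<comment> \<open>The inner product of \<open>z\<close> with \<open>\<i> * s\<close>, divided by
    the squared norm of \<open>s\<close>.\<close>
  define r where "r = (Im z * Re s - Re z * Im s) / ((Re s)\<^sup>2 + (Im s)\<^sup>2)"
  have "Re z * ((Re s)\<^sup>2 + (Im s)\<^sup>2) = - ((Im z * Re s - Re z * Im s) * Im s)"
    "Im z * ((Re s)\<^sup>2 + (Im s)\<^sup>2) = (Im z * Re s - Re z * Im s) * Re s"
    using o by (simp_all add: power2_eq_square algebra_simps) algebra+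
  then have "z = r *\<^sub>R (\<i> * s)"
    using n by (simp add: complex_eq_iff r_def field_simps)
  then show ?thesis using that by blast
qed

text \<open>
  A direction network with generic directions has a one-dimensional solution space, and a solution
  that collapses an arc \<open>c\<close> would also solve the network in which \<open>c\<close> is doubled, which only has
  the zero solution.  So the realization has no collapsed arc, and its rigidity matrix is, up to
  scaling of the rows and a rotation by \<open>pi / 2\<close>, the matrix of the direction network.
\<close>

lemma full_rank_if_cone_laman:
  fixes G :: "('w::finite, 'e::finite) pre_digraph"
  assumes k: "k > 0" and col: "colored_graph k G \<gamma>" and V: "verts G = UNIV"
    and laman: "cone_laman k G \<gamma>"
  obtains p where "\<And>a. a \<in> arcs G \<Longrightarrow> arc_vec k G \<gamma> a p \<noteq> 0" "2 * CARD('w) \<le> jacobian_rank k G \<gamma> p + 1"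
proof -
  let ?L = "\<lambda>a. adjoint (arc_vec k G \<gamma> a)"
  have linL: "linear (?L a)" for a
    by (rule adjoint_linear[OF linear_arc_vec])
  have adj: "?L a z \<bullet> y = arc_vec k G \<gamma> a y \<bullet> z" for a y z
    using adjoint_works[OF linear_arc_vec] by (metis inner_commute)
  obtain s where s: "\<And>a. s a \<noteq> 0"
    "\<And>c. c \<in> arcs G \<Longrightarrow> card (arcs G) + 1 \<le> dim (range (?L c) \<union> (\<lambda>a. ?L a (s a)) ` arcs G)"
    using generic_directions[of "arcs G" ?L, OF finite linL
        arc_ranges_count_if_cone_laman[OF k col V laman]] by blast
  \<comment> \<open>One equation per arc: a vector annihilated by \<open>T\<close> has each arc
    vector orthogonal to its direction \<open>s a\<close>. There is one equation fewer than there
    are real unknowns.\<close>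
  define T where "T = (\<lambda>a. ?L a (s a)) ` arcs G"
  have m: "card (arcs G) + 1 = 2 * CARD('w)"
    using laman V by (simp add: cone_laman_def)
  have "dim T \<le> card (arcs G)"
    unfolding T_def by (rule dim_image_le_card[OF finite])
  then have "dim {y. \<forall>x\<in>T. x \<bullet> y = 0} \<noteq> 0"
    using dim_annihilator[of T] m unfolding DIM_cart DIM_complex by linarith
  then have "\<not> {y. \<forall>x\<in>T. x \<bullet> y = 0} \<subseteq> {0}"
    by (simp add: dim_eq_0)
  then obtain p where p: "p \<noteq> 0" "\<And>x. x \<in> T \<Longrightarrow> x \<bullet> p = 0" by blast
  have nz: "arc_vec k G \<gamma> c p \<noteq> 0" if c: "c \<in> arcs G" for c
  proof
    assume "arc_vec k G \<gamma> c p = 0"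
    then have "\<forall>x\<in>range (?L c) \<union> T. x \<bullet> p = 0"
      using p(2) by (auto simp: adj)
    moreover have "dim {y. \<forall>x\<in>range (?L c) \<union> T. x \<bullet> y = 0} = 0"
      using dim_annihilator[of "range (?L c) \<union> T"] s(2)[OF c] m
      unfolding T_def DIM_cart DIM_complex by linarith
    ultimately show False
      using p(1) by (auto simp: dim_eq_0)
  qed
  have "card (arcs G) > 0" using m by (cases "card (arcs G)") auto
  then obtain c where c: "c \<in> arcs G" by (auto simp: card_gt_0_iff)
  have "2 * CARD('w) \<le> dim (range (?L c) \<union> T)" using s(2)[OF c] m by (simp add: T_def)
  \<comment> \<open>\<open>s c\<close> and \<open>\<i> * s c\<close> form a real basis of the plane
    and \<open>?L c (s c)\<close> already lies in \<open>T\<close>, so doubling \<open>c\<close>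
    adds a single vector; hence \<open>T\<close> has corank at most 1.\<close>
  also have "\<dots> \<le> dim (insert (?L c (\<i> * s c)) T)"
  proof (rule dim_mono)
    have "?L c z \<in> span (insert (?L c (\<i> * s c)) T)" for z
    proof -
      define u where "u = z / s c"
      have "z = Re u *\<^sub>R s c + Im u *\<^sub>R (\<i> * s c)"
        using s(1)[of c] complex_eq[of u]
        by (simp add: u_def scaleR_conv_of_real flip: mult.assoc) (metis distrib_right mult.commute nonzero_divide_eq_eq)
      then have "?L c z = Re u *\<^sub>R ?L c (s c) + Im u *\<^sub>R ?L c (\<i> * s c)"
        using linear_add[OF linL] linear_scale[OF linL] by metis
      moreover have "?L c (s c) \<in> span (insert (?L c (\<i> * s c)) T)"
        using c by (intro span_base) (simp add: T_def)
      ultimately show ?thesis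
        by (simp add: span_add span_scale span_base)
    qed
    then show "range (?L c) \<union> T \<subseteq> span (insert (?L c (\<i> * s c)) T)"
      by (auto intro: span_base)
  qed
  also have "\<dots> \<le> dim T + 1" by (simp add: dim_insert)
  finally have "dim {y. \<forall>x\<in>T. x \<bullet> y = 0} \<le> 1"
    using dim_annihilator[of T] by simp
  moreover have "dim {h. squared_lengths_deriv k G \<gamma> p h = 0} \<le> dim {y. \<forall>x\<in>T. x \<bullet> y = 0}"
  proof -
    let ?K = "{h. squared_lengths_deriv k G \<gamma> p h = 0}"
    \<comment> \<open>Since \<open>p\<close> solves the network, each arc vector is a non-zero real
      multiple of \<open>\<i> * s a\<close>; orthogonality of the arc vector of \<open>h\<close> to
      it becomes orthogonality of the arc vector of \<open>spin h\<close> to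
      \<open>s a\<close>.\<close>
    have "spin ` ?K \<subseteq> {y. \<forall>x\<in>T. x \<bullet> y = 0}"
    proof clarify
      fix h x assume h: "squared_lengths_deriv k G \<gamma> p h = 0" and "x \<in> T"
      then obtain a where a: "a \<in> arcs G" "x = ?L a (s a)" by (auto simp: T_def)
      then have "arc_vec k G \<gamma> a p \<bullet> s a = 0"
        using p(2)[of x] \<open>x \<in> T\<close> by (simp add: adj)
      then obtain r where r: "arc_vec k G \<gamma> a p = r *\<^sub>R (\<i> * s a)"
        using s(1)[of a] by (rule orthogonal_complex)
      have "squared_lengths_deriv k G \<gamma> p h $ a = 0" using h by simp
      then have "arc_vec k G \<gamma> a p \<bullet> arc_vec k G \<gamma> a h = 0"
        using a(1) by (simp add: squared_lengths_deriv_def)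
      then have "(\<i> * s a) \<bullet> arc_vec k G \<gamma> a h = 0"
        using r nz[OF a(1)] by auto
      then show "x \<bullet> spin h = 0"
        by (simp add: a adj arc_vec_spin inner_complex_def algebra_simps)
    qed
    then have "dim (spin ` ?K) \<le> dim {y. \<forall>x\<in>T. x \<bullet> y = 0}" by (rule dim_subset)
    moreover have "inj spin" by (rule injI) (metis neg_equal_iff_equal spin_spin)
    then have "dim (spin ` ?K) = dim ?K"
      by (intro dim_image_eq linear_spin) (auto intro: inj_on_subset)
    ultimately show ?thesis by simp
  qed
  ultimately have "2 * CARD('w) \<le> jacobian_rank k G \<gamma> p + 1"
    using jacobian_rank_kernel[of k G \<gamma> p] by linarith
  then show ?thesis using that nz by blast
qed

section \<open>Frameworks and their colored graphs\<close>

locale framework_reps =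
  fixes k :: nat and \<phi> :: "int \<Rightarrow> 'v::finite \<Rightarrow> 'v" and E :: "'v set set" and l :: "'v set \<Rightarrow> real"
    and rep :: "'w::finite \<Rightarrow> 'v" and G :: "('w, 'e::finite) pre_digraph" and \<gamma> :: "'e \<Rightarrow> int"
  assumes k_pos: "k > 0"
    and framework: "cone_framework k \<phi> E l"
    and assoc: "associated_colored_graph k \<phi> E rep G \<gamma>"
begin

abbreviation Z where "Z \<equiv> integer_mod_group k"

definition arc_edge :: "'e \<Rightarrow> 'v set"
  where "arc_edge a = {rep (tail G a), \<phi> (\<gamma> a) (rep (head G a))}"

lemma graph: "free_symmetric_graph k \<phi> E"
  using framework by (simp add: cone_framework_def)

lemma act: "group_action Z UNIV \<phi>"
  using graph by (simp add: free_symmetric_graph_def)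

lemma colored: "colored_graph k G \<gamma>" and verts_G: "verts G = UNIV"
  using assoc by (simp_all add: associated_colored_graph_def)

lemma carrier_Z: "carrier Z = {0..<int k}"
  using k_pos by (simp add: carrier_integer_mod_group)

lemma phi_comp: "g \<in> carrier Z \<Longrightarrow> h \<in> carrier Z \<Longrightarrow> \<phi> ((g + h) mod int k) v = \<phi> g (\<phi> h v)"
  using group_action.composition_rule[OF act, of v g h] by simp

lemma phi_zero: "\<phi> 0 v = v"
  using group_action.id_eq_one[OF act] by (simp add: fun_eq_iff)

lemma phi_neg: "g \<in> carrier Z \<Longrightarrow> \<phi> ((- g) mod int k) (\<phi> g v) = v"
  using phi_comp[of "(- g) mod int k" g v] k_pos by (simp add: carrier_Z phi_zero mod_simps)

lemma neg_carrier: "(- g) mod int k \<in> carrier Z"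
  using k_pos by (simp add: carrier_Z)

lemma color_carrier: "a \<in> arcs G \<Longrightarrow> \<gamma> a \<in> carrier Z"
  using colored by (simp add: colored_graph_def)

lemma vertex_rep: "\<exists>i. \<exists>g\<in>carrier Z. v = \<phi> g (rep i)"
proof -
  have "Group_Action.orbit Z \<phi> v \<in> range (\<lambda>i. Group_Action.orbit Z \<phi> (rep i))"
    using assoc by (auto simp: associated_colored_graph_def bij_betw_def orbits_def)
  then obtain i where "Group_Action.orbit Z \<phi> v = Group_Action.orbit Z \<phi> (rep i)" by auto
  moreover have "v \<in> Group_Action.orbit Z \<phi> v"
    using group_action.orbit_refl[OF act] by simp
  ultimately show ?thesis by (auto simp: Group_Action.orbit_def)
qed

lemma edge_orbit_eq: "edge_orbit k \<phi> e = {\<phi> g ` e |g. g \<in> carrier Z}"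
  by (simp add: edge_orbit_def Group_Action.orbit_def)

lemma edge_orbit_refl: "e \<in> edge_orbit k \<phi> e"
  unfolding edge_orbit_eq by (auto simp: phi_zero intro!: exI[of _ 0])

lemma edge_orbit_sym:
  assumes "e \<in> edge_orbit k \<phi> f" shows "f \<in> edge_orbit k \<phi> e"
proof -
  obtain g where g: "g \<in> carrier Z" "e = \<phi> g ` f" using assms by (auto simp: edge_orbit_eq)
  then have "f = \<phi> ((- g) mod int k) ` e" by (simp add: image_image phi_neg)
  then show ?thesis using neg_carrier by (auto simp: edge_orbit_eq)
qed

lemma edge_orbit_trans:
  assumes "e \<in> edge_orbit k \<phi> f" "f \<in> edge_orbit k \<phi> d"
  shows "e \<in> edge_orbit k \<phi> d"
proof -
  obtain g where g: "g \<in> carrier Z" "e = \<phi> g ` f" using assms by (auto simp: edge_orbit_eq)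
  obtain h where h: "h \<in> carrier Z" "f = \<phi> h ` d" using assms by (auto simp: edge_orbit_eq)
  have "e = \<phi> ((g + h) mod int k) ` d" using g h by (simp add: image_image phi_comp)
  moreover have "(g + h) mod int k \<in> carrier Z" using k_pos by (simp add: carrier_Z)
  ultimately show ?thesis by (auto simp: edge_orbit_eq)
qed

lemma edge_orbit_cong: "edge_orbit k \<phi> e = edge_orbit k \<phi> f \<longleftrightarrow> e \<in> edge_orbit k \<phi> f"
  using edge_orbit_refl edge_orbit_sym edge_orbit_trans by blast

lemma arcs_orbits:
  "bij_betw (\<lambda>a. edge_orbit k \<phi> (arc_edge a)) (arcs G) (edge_orbit k \<phi> ` E)"
  using assoc by (simp add: associated_colored_graph_def arc_edge_def)

lemma edge_arc:
  assumes "e \<in> E"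
  obtains a where "a \<in> arcs G" "e \<in> edge_orbit k \<phi> (arc_edge a)"
proof -
  have "edge_orbit k \<phi> e \<in> (\<lambda>a. edge_orbit k \<phi> (arc_edge a)) ` arcs G"
    using arcs_orbits assms by (auto simp: bij_betw_def)
  then show ?thesis using that edge_orbit_cong by blast
qed

lemma arc_edge_in: "a \<in> arcs G \<Longrightarrow> p \<in> realizations k \<phi> E l \<Longrightarrow> arc_edge a \<in> E"
  unfolding arc_edge_def by (rule realization_arc_nonzero(2)[OF k_pos framework assoc])

section \<open>Passage between symmetric realizations and tuples of representatives\<close>

definition equivariant :: "complex ^ 'v \<Rightarrow> bool"
  where "equivariant q \<longleftrightarrow> (\<forall>g\<in>carrier Z. \<forall>i. cone_rot k g (q $ i) = q $ \<phi> g i)"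

lemma realization_equivariant: "q \<in> realizations k \<phi> E' l' \<Longrightarrow> equivariant q"
  by (simp add: realizations_def equivariant_def)

lemma arc_vec_restrict:
  assumes "equivariant q" "a \<in> arcs G"
  shows "arc_vec k G \<gamma> a (restrict_to_reps rep q) = q $ \<phi> (\<gamma> a) (rep (head G a)) - q $ rep (tail G a)"
  using assms color_carrier by (simp add: arc_vec_def restrict_to_reps_def equivariant_def)

lemma arc_length:
  assumes "q \<in> realizations k \<phi> E l" "a \<in> arcs G"
  shows "norm (arc_vec k G \<gamma> a (restrict_to_reps rep q)) = l (arc_edge a)"
  using assms arc_edge_in[of a q]
  by (simp add: arc_vec_restrict realization_equivariant) (simp add: realizations_def arc_edge_def)

lemma edge_length:
  assumes a: "a \<in> arcs G" and e: "{i, j} \<in> edge_orbit k \<phi> (arc_edge a)" and q: "equivariant q"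
  shows "norm (q $ j - q $ i) = norm (arc_vec k G \<gamma> a (restrict_to_reps rep q))"
proof -
  obtain g where g: "g \<in> carrier Z" "{i, j} = {\<phi> g (rep (tail G a)), \<phi> g (\<phi> (\<gamma> a) (rep (head G a)))}"
    using e by (auto simp: edge_orbit_eq arc_edge_def)
  then have "norm (q $ j - q $ i) = norm (q $ \<phi> g (\<phi> (\<gamma> a) (rep (head G a))) - q $ \<phi> g (rep (tail G a)))"
    by (auto simp: doubleton_eq_iff norm_minus_commute)
  also have "\<dots> = norm (cone_rot k g (q $ \<phi> (\<gamma> a) (rep (head G a))) - cone_rot k g (q $ rep (tail G a)))"
    using q g(1) by (simp add: equivariant_def)
  also have "\<dots> = norm (arc_vec k G \<gamma> a (restrict_to_reps rep q))"
    by (simp add: norm_cone_rot_diff arc_vec_restrict[OF q a])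
  finally show ?thesis .
qed

lemma squared_lengths_eq_iff:
  "squared_lengths k G \<gamma> r = squared_lengths k G \<gamma> s \<longleftrightarrow>
     (\<forall>a\<in>arcs G. norm (arc_vec k G \<gamma> a r) = norm (arc_vec k G \<gamma> a s))"
  by (auto simp: squared_lengths_def vec_eq_iff simp flip: arc_vec_def)

text \<open>Equal lengths keep all arcs uncollapsed, so \<open>r\<close> extends equivariantly to a
  realization for some lengths. These agree with \<open>l\<close> on \<open>E\<close> because each
  edge lies in the orbit of an arc edge, whose length is read off from \<open>r\<close>.\<close>

lemma realization_lift:
  assumes q: "q \<in> realizations k \<phi> E l"
    and r: "squared_lengths k G \<gamma> r = squared_lengths k G \<gamma> (restrict_to_reps rep q)"
  obtains q' where "q' \<in> realizations k \<phi> E l" "restrict_to_reps rep q' = r"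
proof -
  have len: "norm (arc_vec k G \<gamma> a r) = norm (arc_vec k G \<gamma> a (restrict_to_reps rep q))"
    if "a \<in> arcs G" for a
    using r that by (simp add: squared_lengths_eq_iff)
  have "cone_rot k (\<gamma> a) (r $ head G a) \<noteq> r $ tail G a" if a: "a \<in> arcs G" for a
  proof -
    have "arc_vec k G \<gamma> a (restrict_to_reps rep q) \<noteq> 0"
      using realization_arc_nonzero(1)[OF k_pos framework assoc q a] by (simp add: arc_vec_def)
    then have "arc_vec k G \<gamma> a r \<noteq> 0" using len[OF a] by (metis norm_eq_zero)
    then show ?thesis by (simp add: arc_vec_def)
  qed
  then obtain l' q' where q': "q' \<in> realizations k \<phi> E l'" "restrict_to_reps rep q' = r"
    using ex_realization_over_reps[OF k_pos graph assoc, of r] by blast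
  have "norm (q' $ j - q' $ i) = l {i, j}" if e: "{i, j} \<in> E" for i j
  proof -
    obtain a where a: "a \<in> arcs G" "{i, j} \<in> edge_orbit k \<phi> (arc_edge a)"
      using edge_arc[OF e] .
    have "norm (q' $ j - q' $ i) = norm (q $ j - q $ i)"
      using edge_length[OF a] realization_equivariant[OF q] realization_equivariant[OF q'(1)]
        len[OF a(1)] q'(2) by simp
    then show ?thesis using q e by (simp add: realizations_def)
  qed
  then have "q' \<in> realizations k \<phi> E l"
    using q'(1) by (simp add: realizations_def)
  then show ?thesis using that q'(2) by blast
qed

lemma squared_lengths_realization:
  assumes "q \<in> realizations k \<phi> E l" "q' \<in> realizations k \<phi> E l"
  shows "squared_lengths k G \<gamma> (restrict_to_reps rep q) = squared_lengths k G \<gamma> (restrict_to_reps rep q')"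
  using assms by (simp add: squared_lengths_eq_iff arc_length)

lemma dist_restrict_le:
  "dist (restrict_to_reps rep q) (restrict_to_reps rep q') \<le> real CARD('w) * dist q q'"
proof -
  have "dist (restrict_to_reps rep q) (restrict_to_reps rep q') \<le>
      (\<Sum>i\<in>UNIV. dist (restrict_to_reps rep q $ i) (restrict_to_reps rep q' $ i))"
    unfolding dist_vec_def by (rule L2_set_le_sum) simp
  also have "\<dots> \<le> (\<Sum>i\<in>(UNIV::'w set). dist q q')"
    by (intro sum_mono) (simp add: restrict_to_reps_def dist_vec_nth_le)
  finally show ?thesis by simp
qed

text \<open>Rotations are isometries, so every coordinate distance equals one at a representative.
  Together with \<open>dist_restrict_le\<close> this makes restriction bi-Lipschitz on equivariant
  point sets.\<close>

lemma dist_le_restrict: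
  assumes "equivariant q" "equivariant q'"
  shows "dist q q' \<le> real CARD('v) * dist (restrict_to_reps rep q) (restrict_to_reps rep q')"
proof -
  have "dist (q $ v) (q' $ v) \<le> dist (restrict_to_reps rep q) (restrict_to_reps rep q')" for v
  proof -
    obtain i g where v: "g \<in> carrier Z" "v = \<phi> g (rep i)" using vertex_rep by blast
    then have "dist (q $ v) (q' $ v) = dist (cone_rot k g (q $ rep i)) (cone_rot k g (q' $ rep i))"
      using assms by (simp add: equivariant_def)
    also have "\<dots> = dist (restrict_to_reps rep q $ i) (restrict_to_reps rep q' $ i)"
      by (simp add: dist_norm norm_cone_rot_diff restrict_to_reps_def)
    finally show ?thesis by (simp add: dist_vec_nth_le)
  qed
  then have "(\<Sum>v\<in>UNIV. dist (q $ v) (q' $ v)) \<le>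
      (\<Sum>v\<in>(UNIV::'v set). dist (restrict_to_reps rep q) (restrict_to_reps rep q'))"
    by (intro sum_mono)
  moreover have "dist q q' \<le> (\<Sum>v\<in>UNIV. dist (q $ v) (q' $ v))"
    unfolding dist_vec_def by (rule L2_set_le_sum) simp
  ultimately show ?thesis by simp
qed

lemma restrict_turn: "restrict_to_reps rep (turn t q) = turn t (restrict_to_reps rep q)"
  by (simp add: restrict_to_reps_def turn_def)

lemma restrict_inj:
  assumes "equivariant q" "equivariant q'" "restrict_to_reps rep q = restrict_to_reps rep q'"
  shows "q = q'"
  using dist_le_restrict[OF assms(1,2)] assms(3) by simp

lemma realization_turn:
  assumes "q \<in> realizations k \<phi> E l"
  shows "turn t q \<in> realizations k \<phi> E l"
proof -
  have "norm (cis t * q $ j - cis t * q $ i) = norm (q $ j - q $ i)" for i j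
    by (simp add: norm_mult flip: right_diff_distrib)
  moreover have "cone_rot k g (cis t * z) = cis t * cone_rot k g z" for g z
    by (simp add: cone_rot_def)
  ultimately show ?thesis
    using assms by (simp add: realizations_def turn_def)
qed

lemma rotation_class_turn: "rotation_class q = {turn t q |t. True}"
  by (simp add: rotation_class_def turn_def)

lemma rotation_class_eq: "rotation_class q = rotation_class p \<longleftrightarrow> (\<exists>t. q = turn t p)"
proof
  assume "rotation_class q = rotation_class p"
  moreover have "q \<in> rotation_class q"
    unfolding rotation_class_turn by (auto intro!: exI[of _ 0] simp: turn_0)
  ultimately show "\<exists>t. q = turn t p" by (auto simp: rotation_class_turn)
next
  assume "\<exists>t. q = turn t p"
  then obtain t where t: "q = turn t p" by blast
  have "turn s p = turn (s - t) (turn t p)" for s by (simp add: turn_turn)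
  moreover have "turn s (turn t p) = turn (s + t) p" for s by (simp add: turn_turn)
  ultimately show "rotation_class q = rotation_class p"
    unfolding rotation_class_turn t by blast
qed

text \<open>A class is isolated in the quotient topology iff its preimage, the rotation orbit of
  \<open>p\<close>, is open among the realizations. The two distance estimates carry neighbourhoods
  to tuples of representatives, and \<open>realization_lift\<close> leads back.\<close>

lemma rigid_iff_locally_rigid:
  assumes p: "p \<in> realizations k \<phi> E l"
  shows "rigid k \<phi> E l p \<longleftrightarrow> locally_rigid k G \<gamma> (restrict_to_reps rep p)"
proof -
  let ?R = "realizations k \<phi> E l" and ?r = "restrict_to_reps rep"
  let ?O = "{q \<in> ?R. \<exists>t. q = turn t p}"
  have "rigid k \<phi> E l p \<longleftrightarrow> openin (top_of_set ?R) ?O"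
    using p imageI[OF p, of rotation_class] by (simp add: rigid_def openin_config_space rotation_class_eq)
  also have "\<dots> \<longleftrightarrow> (\<forall>x\<in>?O. \<exists>e>0. \<forall>x'\<in>?R. dist x' x < e \<longrightarrow> x' \<in> ?O)"
    unfolding openin_euclidean_subtopology_iff by blast
  also have "\<dots> \<longleftrightarrow> locally_rigid k G \<gamma> (?r p)"
  proof
    assume "\<forall>x\<in>?O. \<exists>e>0. \<forall>x'\<in>?R. dist x' x < e \<longrightarrow> x' \<in> ?O"
    moreover have "p \<in> ?O" using p by (auto intro!: exI[of _ 0] simp: turn_0)
    ultimately obtain e where e: "e > 0" "\<And>x'. x' \<in> ?R \<Longrightarrow> dist x' p < e \<Longrightarrow> x' \<in> ?O"
      by blast
    have "\<exists>t. r = turn t (?r p)"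
      if r: "dist r (?r p) < e / real CARD('v)" "squared_lengths k G \<gamma> r = squared_lengths k G \<gamma> (?r p)" for r
    proof -
      obtain q where q: "q \<in> ?R" "?r q = r" using realization_lift[OF p r(2)] .
      have "dist q p \<le> real CARD('v) * dist r (?r p)"
        using dist_le_restrict[OF realization_equivariant[OF q(1)] realization_equivariant[OF p]] q(2) by simp
      also have "\<dots> < e" using r(1) by (simp add: field_simps)
      finally obtain t where "q = turn t p" using e(2)[OF q(1)] by blast
      then show ?thesis using q(2) restrict_turn by blast
    qed
    then show "locally_rigid k G \<gamma> (?r p)"
      unfolding locally_rigid_def using e(1) by (intro exI[of _ "e / real CARD('v)"]) simp
  next
    assume "locally_rigid k G \<gamma> (?r p)"
    then obtain e where e: "e > 0"
      "\<And>r. dist r (?r p) < e \<Longrightarrow> squared_lengths k G \<gamma> r = squared_lengths k G \<gamma> (?r p) \<Longrightarrow> \<exists>t. r = turn t (?r p)"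
      unfolding locally_rigid_def by blast
    show "\<forall>x\<in>?O. \<exists>e>0. \<forall>x'\<in>?R. dist x' x < e \<longrightarrow> x' \<in> ?O"
    proof (intro ballI exI[of _ "e / real CARD('w)"] conjI impI)
      fix x q assume "x \<in> ?O" and q: "q \<in> ?R" "dist q x < e / real CARD('w)"
      then obtain t where t: "x = turn t p" by blast
      \<comment> \<open>Openness is needed at every point of the orbit; the isometry
        \<open>turn (- t)\<close> moves the question back to \<open>p\<close>.\<close>
      have q': "turn (- t) q \<in> ?R" using realization_turn[OF q(1)] .
      have "dist (turn (- t) q) p = norm (turn (- t) (q - x))"
        by (simp add: dist_norm t linear_diff[OF linear_turn] turn_turn turn_0)
      then have "dist (turn (- t) q) p = dist q x"
        by (simp add: norm_turn dist_norm)
      then have "dist (?r (turn (- t) q)) (?r p) < e"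
        using dist_restrict_le[of "turn (- t) q" p] q(2) by (simp add: field_simps)
      then obtain s where "?r (turn (- t) q) = turn s (?r p)"
        using e(2) squared_lengths_realization[OF q' p] by blast
      then have "turn (- t) q = turn s p"
        using restrict_inj[OF realization_equivariant[OF q'] realization_equivariant[OF realization_turn[OF p]]]
        by (simp add: restrict_turn)
      then have "turn t (turn (- t) q) = turn t (turn s p)" by simp
      then have "q = turn (t + s) p" by (simp add: turn_turn turn_0)
      then show "q \<in> ?O" using q(1) by blast
    qed (use e in auto)
  qed
  finally show ?thesis .
qed

text \<open>An edge orbit upstairs is a single arc below, so after its removal the same
  representatives and colors still describe the quotient, and the rigidity criteria apply to the
  smaller framework.\<close>

lemma remove_arc:
  assumes a: "a \<in> arcs G" and e: "e \<in> E" "e \<in> edge_orbit k \<phi> (arc_edge a)"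
  shows "framework_reps k \<phi> (E - edge_orbit k \<phi> e) l rep (G\<lparr>arcs := arcs G - {a}\<rparr>) \<gamma>"
proof
  let ?E = "E - edge_orbit k \<phi> e" and ?G = "G\<lparr>arcs := arcs G - {a}\<rparr>"
  let ?f = "\<lambda>a. edge_orbit k \<phi> (arc_edge a)"
  show "k > 0" by (rule k_pos)
  have "\<phi> g ` f \<in> ?E" if g: "g \<in> carrier Z" and f: "f \<in> ?E" for g f
  proof -
    have "\<phi> g ` f \<in> edge_orbit k \<phi> f" using g by (auto simp: edge_orbit_eq)
    then have "\<phi> g ` f \<notin> edge_orbit k \<phi> e"
      using f edge_orbit_sym edge_orbit_trans by blast
    then show ?thesis using g f graph by (simp add: free_symmetric_graph_def)
  qed
  then show "cone_framework k \<phi> ?E l"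
    using framework by (simp add: cone_framework_def free_symmetric_graph_def)
  have "colored_graph k ?G \<gamma>"
    using colored by (auto simp: colored_graph_def fin_digraph_def fin_digraph_axioms_def wf_digraph_def)
  moreover have "bij_betw ?f (arcs G - {a}) (edge_orbit k \<phi> ` E - {?f a})"
  proof -
    have f: "inj_on ?f (arcs G)" "?f ` arcs G = edge_orbit k \<phi> ` E"
      using arcs_orbits by (simp_all add: bij_betw_def)
    then have "?f ` (arcs G - {a}) = edge_orbit k \<phi> ` E - {?f a}"
      using inj_on_image_set_diff[of ?f "arcs G" "arcs G" "{a}"] a by simp
    then show ?thesis
      unfolding bij_betw_def using inj_on_diff[OF f(1)] by simp
  qed
  moreover have "edge_orbit k \<phi> ` E - {edge_orbit k \<phi> (arc_edge a)} = edge_orbit k \<phi> ` ?E"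
  proof -
    have "edge_orbit k \<phi> (arc_edge a) = edge_orbit k \<phi> e"
      using e(2) edge_orbit_cong by blast
    then show ?thesis
      using edge_orbit_cong[of _ e] by blast
  qed
  ultimately show "associated_colored_graph k \<phi> ?E rep ?G \<gamma>"
    using assoc by (simp add: associated_colored_graph_def arc_edge_def)
qed

end

section \<open>Rank under deletion of arcs and minimal rigidity\<close>

lemma arc_vec_remove_arcs: "arc_vec k (G\<lparr>arcs := B\<rparr>) \<gamma> = arc_vec k G \<gamma>"
  by (simp add: fun_eq_iff arc_vec_def)

lemma jacobian_rank_remove_arcs:
  fixes G :: "('w::finite, 'e::finite) pre_digraph"
  shows "jacobian_rank k (G\<lparr>arcs := B\<rparr>) \<gamma> r = dim (arc_row k G \<gamma> r ` B)"
proof -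
  have "arc_row k (G\<lparr>arcs := B\<rparr>) \<gamma> r = arc_row k G \<gamma> r"
    by (simp add: fun_eq_iff arc_row_def arc_vec_remove_arcs)
  then show ?thesis by (simp add: jacobian_rank_eq)
qed

text \<open>The rotation \<open>spin r\<close> is a non-zero kernel vector unless
  \<open>r = 0\<close>, where the whole derivative vanishes.\<close>

lemma jacobian_rank_less:
  fixes G :: "('w::finite, 'e::finite) pre_digraph"
  shows "jacobian_rank k G \<gamma> r + 1 \<le> 2 * CARD('w)"
proof (cases "r = 0")
  case True
  then have "{h. squared_lengths_deriv k G \<gamma> r h = 0} = UNIV"
    using linear_0[OF linear_squared_lengths_deriv_left] by auto
  then show ?thesis using jacobian_rank_kernel[of k G \<gamma> r] by simp
next
  case False
  then have "spin r \<noteq> 0" using inner_spin(2)[of r] by auto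
  then have "\<not> {h. squared_lengths_deriv k G \<gamma> r h = 0} \<subseteq> {0}"
    using squared_lengths_deriv_spin[of k G \<gamma> r] by blast
  then have "dim {h. squared_lengths_deriv k G \<gamma> r h = 0} > 0"
    by (simp add: dim_eq_0 flip: neq0_conv)
  then show ?thesis using jacobian_rank_kernel[of k G \<gamma> r] by linarith
qed

context framework_reps
begin

text \<open>Deleting a redundant row preserves the rank and with it the rigidity, so minimality
  means that the rows are independent.\<close>

lemma minimally_rigid_iff_rank:
  assumes p: "p \<in> realizations k \<phi> E l"
    and max: "\<And>r. (\<forall>a\<in>arcs G. arc_vec k G \<gamma> a r \<noteq> 0) \<Longrightarrow>
      jacobian_rank k G \<gamma> r \<le> jacobian_rank k G \<gamma> (restrict_to_reps rep p)"
  shows "minimally_rigid k \<phi> E l p \<longleftrightarrow>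
    jacobian_rank k G \<gamma> (restrict_to_reps rep p) = card (arcs G) \<and> card (arcs G) + 1 = 2 * CARD('w)"
    (is "_ \<longleftrightarrow> ?R")
proof -
  let ?r = "restrict_to_reps rep p"
  have p': "p \<in> realizations k \<phi> (E - F) l" for F
    using p by (simp add: realizations_def)
  have rank_less: "jacobian_rank k G \<gamma> ?r + 1 \<le> 2 * CARD('w)"
    by (rule jacobian_rank_less)
  have rigid_rank: "rigid k \<phi> E l p \<longleftrightarrow> jacobian_rank k G \<gamma> ?r + 1 = 2 * CARD('w)"
  proof
    assume "rigid k \<phi> E l p"
    then have lr: "locally_rigid k G \<gamma> ?r" by (simp add: rigid_iff_locally_rigid[OF p])
    \<comment> \<open>The tuples without collapsed arcs form an open set containing
      \<open>?r\<close>, which turns the assumption on competing ranks into the local maximality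
      that the criterion asks for.\<close>
    let ?U = "\<Inter>a\<in>arcs G. {r. arc_vec k G \<gamma> a r \<noteq> 0}"
    have "continuous_on UNIV (arc_vec k G \<gamma> a)" for a
      by (intro linear_continuous_on) (simp add: linear_arc_vec flip: linear_conv_bounded_linear)
    then have "open ?U"
      by (intro open_INT ballI open_Collect_neq continuous_on_const) auto
    moreover have "?r \<in> ?U"
      using realization_arc_nonzero(1)[OF k_pos framework assoc p] by (simp add: arc_vec_def)
    ultimately have "\<not> jacobian_rank k G \<gamma> ?r + 2 \<le> 2 * CARD('w)"
      using not_locally_rigid_if_rank[of k G \<gamma> ?r ?U] max lr by auto
    then show "jacobian_rank k G \<gamma> ?r + 1 = 2 * CARD('w)" using rank_less by linarith
  next
    assume "jacobian_rank k G \<gamma> ?r + 1 = 2 * CARD('w)"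
    then show "rigid k \<phi> E l p"
      unfolding rigid_iff_locally_rigid[OF p] by (rule locally_rigid_if_rank)
  qed
  show ?thesis
  proof
    assume min: "minimally_rigid k \<phi> E l p"
    then have full: "jacobian_rank k G \<gamma> ?r + 1 = 2 * CARD('w)"
      using rigid_rank by (simp add: minimally_rigid_def)
    have "jacobian_rank k G \<gamma> ?r = card (arcs G)"
    proof (rule ccontr)
      assume "jacobian_rank k G \<gamma> ?r \<noteq> card (arcs G)"
      then have "dim (arc_row k G \<gamma> ?r ` arcs G) < card (arcs G)"
        using dim_image_le_card[of "arcs G" "arc_row k G \<gamma> ?r"] by (simp add: jacobian_rank_eq)
      then obtain a where a: "a \<in> arcs G"
        "dim (arc_row k G \<gamma> ?r ` (arcs G - {a})) = dim (arc_row k G \<gamma> ?r ` arcs G)"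
        using dim_span_redundant[of "arcs G" "arc_row k G \<gamma> ?r"] by auto
      have aE: "arc_edge a \<in> E" using arc_edge_in[OF a(1) p] .
      interpret H: framework_reps k \<phi> "E - edge_orbit k \<phi> (arc_edge a)" l rep "G\<lparr>arcs := arcs G - {a}\<rparr>" \<gamma>
        by (rule remove_arc[OF a(1) aE edge_orbit_refl])
      have "jacobian_rank k (G\<lparr>arcs := arcs G - {a}\<rparr>) \<gamma> ?r + 1 = 2 * CARD('w)"
        unfolding jacobian_rank_remove_arcs a(2) using full by (simp add: jacobian_rank_eq)
      then have "rigid k \<phi> (E - edge_orbit k \<phi> (arc_edge a)) l p"
        unfolding H.rigid_iff_locally_rigid[OF p'] by (rule locally_rigid_if_rank)
      then show False using min aE by (simp add: minimally_rigid_def)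
    qed
    then show ?R using full by simp
  next
    assume R: ?R
    have "\<not> rigid k \<phi> (E - edge_orbit k \<phi> e) l p" if e: "e \<in> E" for e
    proof -
      obtain a where a: "a \<in> arcs G" "e \<in> edge_orbit k \<phi> (arc_edge a)" using edge_arc[OF e] .
      let ?G = "G\<lparr>arcs := arcs G - {a}\<rparr>"
      interpret H: framework_reps k \<phi> "E - edge_orbit k \<phi> e" l rep ?G \<gamma>
        by (rule remove_arc[OF a(1) e a(2)])
      have rank: "jacobian_rank k ?G \<gamma> ?r = card (arcs G - {a})"
        unfolding jacobian_rank_remove_arcs
        using R dim_subset_full_rank[of "arcs G" "arc_row k G \<gamma> ?r" "arcs G - {a}"]
        by (simp add: jacobian_rank_eq)
      have "card (arcs G - {a}) + 2 = 2 * CARD('w)"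
        using R card.remove[OF finite a(1)] by simp
      then have "jacobian_rank k ?G \<gamma> ?r + 2 \<le> 2 * CARD('w)" using rank by simp
      \<comment> \<open>Maximality is now global: no tuple exceeds one row per remaining arc, and
        \<open>?r\<close> attains this.\<close>
      then have "\<not> locally_rigid k ?G \<gamma> ?r"
      proof (rule not_locally_rigid_if_rank[OF _ open_UNIV UNIV_I])
        fix q
        have "jacobian_rank k ?G \<gamma> q \<le> card (arcs G - {a})"
          unfolding jacobian_rank_remove_arcs by (rule dim_image_le_card[OF finite])
        then show "jacobian_rank k ?G \<gamma> q \<le> jacobian_rank k ?G \<gamma> ?r" using rank by simp
      qed
      then show ?thesis by (simp add: H.rigid_iff_locally_rigid[OF p'])
    qed
    then show "minimally_rigid k \<phi> E l p"
      using R rigid_rank by (simp add: minimally_rigid_def)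
  qed
qed

end

theorem theorem2:
  fixes k :: nat
    and \<phi> :: "int \<Rightarrow> 'v::finite \<Rightarrow> 'v"
    and E :: "'v set set"
    and l :: "'v set \<Rightarrow> real"
    and rep :: "'w::finite \<Rightarrow> 'v"
    and G :: "('w, 'e::finite) pre_digraph"
    and \<gamma> :: "'e \<Rightarrow> int"
    and p :: "complex ^ 'v"
  assumes "k \<in> {2, 3, 4, 6}"
    and "cone_framework k \<phi> E l"
    and "associated_colored_graph k \<phi> E rep G \<gamma>"
    and "generic_realization k \<phi> E l rep G \<gamma> p"
  shows "minimally_rigid k \<phi> E l p \<longleftrightarrow> cone_laman k G \<gamma>"
proof -
  have k: "k > 0" using assms(1) by auto
  interpret framework_reps k \<phi> E l rep G \<gamma>
    by unfold_locales (fact k assms(2,3))+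
  let ?r = "restrict_to_reps rep p"
  have p: "p \<in> realizations k \<phi> E l"
    using assms(4) by (simp add: generic_realization_def)
  \<comment> \<open>Every tuple without collapsed arcs extends to a realization of the same
    symmetric graph for suitable lengths, so it is among the competitors in the definition of
    genericity.\<close>
  have max: "jacobian_rank k G \<gamma> r \<le> jacobian_rank k G \<gamma> ?r" if "\<forall>a\<in>arcs G. arc_vec k G \<gamma> a r \<noteq> 0" for r
  proof -
    obtain l' q where "cone_framework k \<phi> E l'" "q \<in> realizations k \<phi> E l'" "restrict_to_reps rep q = r"
      using ex_realization_over_reps[OF k graph assms(3), of r] \<open>\<forall>a\<in>arcs G. _\<close>
      by (auto simp: arc_vec_def)
    then show ?thesis
      using assms(3,4) unfolding generic_realization_def by metis
  qed
  have "jacobian_rank k G \<gamma> ?r = card (arcs G) \<and> card (arcs G) + 1 = 2 * CARD('w) \<longleftrightarrow> cone_laman k G \<gamma>"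
  proof
    assume R: "jacobian_rank k G \<gamma> ?r = card (arcs G) \<and> card (arcs G) + 1 = 2 * CARD('w)"
    have "arc_vec k G \<gamma> a ?r \<noteq> 0" if "a \<in> arcs G" for a
      using realization_arc_nonzero(1)[OF k assms(2,3) p that] by (simp add: arc_vec_def)
    note count = subgraph_count_if_independent[OF k colored this]
    have "int (card (arcs H)) \<le> 2 * int (card (verts H)) - 1 - (\<Sum>C\<in>components H. T_number k \<gamma> C)"
      if H: "subgraph H G" "card (arcs H) \<ge> 1" for H
    proof (rule count[OF _ _ H(1)])
      show "dim (arc_row k G \<gamma> ?r ` arcs G) = card (arcs G)"
        using R by (simp add: jacobian_rank_eq)
      show "arcs H \<noteq> {}" using H(2) by auto
    qed
    moreover have "int (card (arcs G)) = 2 * int (card (verts G)) - 1"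
      using R verts_G by simp
    ultimately show "cone_laman k G \<gamma>"
      unfolding cone_laman_def by blast
  next
    assume laman: "cone_laman k G \<gamma>"
    obtain q where "\<And>a. a \<in> arcs G \<Longrightarrow> arc_vec k G \<gamma> a q \<noteq> 0" "2 * CARD('w) \<le> jacobian_rank k G \<gamma> q + 1"
      using full_rank_if_cone_laman[OF k colored verts_G laman] by blast
    then have "2 * CARD('w) \<le> jacobian_rank k G \<gamma> ?r + 1"
      using max[of q] by fastforce
    moreover have "jacobian_rank k G \<gamma> ?r \<le> card (arcs G)"
      unfolding jacobian_rank_eq by (rule dim_image_le_card[OF finite])
    moreover have "card (arcs G) + 1 = 2 * CARD('w)"
      using laman verts_G by (simp add: cone_laman_def)
    ultimately show "jacobian_rank k G \<gamma> ?r = card (arcs G) \<and> card (arcs G) + 1 = 2 * CARD('w)"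
      by linarith
  qed
  then show ?thesis
    using minimally_rigid_iff_rank[OF p max] by blast
qed

end
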